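(* Let $K$ be any field and let $E$ be any directed graph. Let $c$ be a simple closed path in $E$, with $v=s(c)$. Then the Chen simple left $L_K(E)$-module $V_{[c^\infty]}$ is finitely presented. Indeed, a projective resolution of $V_{[c^\infty]}$ is given by $$0 \longrightarrow L_K(E)v \xrightarrow{\ \rho_{c-v}\ } L_K(E)v \xrightarrow{\ \rho_{c^\infty}\ } V_{[c^\infty]} \longrightarrow 0 ,$$ where $\rho_{c-v}(r)=r(c-v)$ and $\rho_{c^\infty}(r)=r\cdot c^\infty$ for $r\in L_K(E)v$. If $E$ is a finite graph, an alternate projective resolution of $V_{[c^\infty]}$ is given by $$0 \longrightarrow L_K(E) \xrightarrow{\ \hat\rho_{c-1}\ } L_K(E) \xrightarrow{\ \hat\rho_{c^\infty}\ } V_{[c^\infty]} \longrightarrow 0 ,$$ where $\hat\rho_{c-1}(r)=r(c-1)$ and $\hat\rho_{c^\infty}(r)=r\cdot c^\infty$ for $r\in L_K(E)$.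
   Context: A directed graph $E=(E^0,E^1,s,r)$ consists of a set $E^0$ of vertices, a set $E^1$ of edges, and maps $s,r:E^1\to E^0$ (source and range); $E$ is finite if $E^0$ and $E^1$ are finite. A path of length $n\ge 1$ is a sequence $\alpha=e_1\cdots e_n$ of edges with $r(e_i)=s(e_{i+1})$; $s(\alpha)=s(e_1)$, $r(\alpha)=r(e_n)$. Vertices are the paths of length $0$. A path $c=e_1\cdots e_n$ (of length $\ge1$) is closed if $r(e_n)=s(e_1)$; a closed path $c$ is called simple if $c\ne\beta^m$ for every closed path $\beta$ and integer $m\ge 2$. The Leavitt path algebra $L_K(E)$ is the $K$-algebra generated by $\{v: v\in E^0\}\cup\{e,e^*: e\in E^1\}$ with relations: (V) $vu=\delta_{v,u}v$ for $v,u\in E^0$; (E1) $s(e)e=er(e)=e$; (E2) $r(e)e^*=e^*s(e)=e^*$ for $e\in E^1$; (CK1) $e^*e'=\delta_{e,e'}r(e)$ for $e,e'\in E^1$; (CK2) $v=\sum_{e\in s^{-1}(v)}ee^*$ for every $v\in E^0$ with $0<|s^{-1}(v)|<\infty$. It is unital iff $E^0$ is finite, with $1=\sum_{v\in E^0}v$. When $E^0$ is infinite, $L_K(E)$ is a ring with local units, and "projective" and "finitely presented" are understood for left modules $M$ with $L_K(E)M=M$. An infinite path is a sequence $p=e_1e_2e_3\cdots$ of edges with $r(e_i)=s(e_{i+1})$ for all $i$; $\tau_{>n}(p)=e_{n+1}e_{n+2}\cdots$. For a closed path $c$, $c^\infty=ccc\cdots$. Infinite paths $p,q$ are tail equivalent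 ($p\sim q$) if $\tau_{>m}(p)=\tau_{>n}(q)$ for some $m,n\geq 0$; $[p]$ is the class of $p$. The Chen simple module $V_{[p]}$ is the $K$-vector space with basis $[p]$ and left $L_K(E)$-action determined, for $q=f_1f_2\cdots\in[p]$, $v\in E^0$, $e\in E^1$, by: $v\cdot q=q$ if $v=s(f_1)$ and $0$ otherwise; $e\cdot q=eq$ if $r(e)=s(f_1)$ and $0$ otherwise; $e^*\cdot q=\tau_{>1}(q)$ if $e=f_1$ and $0$ otherwise. *)

theory Defs
  imports
    "Graph_Theory.Arc_Walk"
    "HOL-Algebra.Generated_Groups"
    "HOL-Algebra.Module"
    "HOL-Algebra.QuotRing"
    "HOL-Library.Poly_Mapping"
    "HOL-Library.Stream"
begin

section \<open>Left modules over rings without identity\<close>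

text \<open>
  The locale \<^locale>\<open>ring\<close> demands an identity and the locale \<^locale>\<open>module\<close> a commutative ring.
  Neither holds for Leavitt path algebras in general, so only the record types are reused.
  The field \<^const>\<open>one\<close> of a ring, and the fields \<^const>\<open>monoid.mult\<close> and \<^const>\<open>one\<close> of a
  module, are never referred to by the notions of this section.
\<close>

locale nonunital_ring = abelian_group R for R (structure) +
  assumes mult_closed: "\<lbrakk>x \<in> carrier R; y \<in> carrier R\<rbrakk> \<Longrightarrow> x \<otimes> y \<in> carrier R"
    and mult_assoc: "\<lbrakk>x \<in> carrier R; y \<in> carrier R; z \<in> carrier R\<rbrakk>
      \<Longrightarrow> (x \<otimes> y) \<otimes> z = x \<otimes> (y \<otimes> z)"
    and distrib_right: "\<lbrakk>x \<in> carrier R; y \<in> carrier R; z \<in> carrier R\<rbrakk>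
      \<Longrightarrow> (x \<oplus> y) \<otimes> z = x \<otimes> z \<oplus> y \<otimes> z"
    and distrib_left: "\<lbrakk>x \<in> carrier R; y \<in> carrier R; z \<in> carrier R\<rbrakk>
      \<Longrightarrow> z \<otimes> (x \<oplus> y) = z \<otimes> x \<oplus> z \<otimes> y"

locale left_module = R?: nonunital_ring R + M?: abelian_group M
  for R (structure) and M (structure) +
  assumes lsmult_closed: "\<lbrakk>a \<in> carrier R; x \<in> carrier M\<rbrakk> \<Longrightarrow> a \<odot>\<^bsub>M\<^esub> x \<in> carrier M"
    and lsmult_l_distr: "\<lbrakk>a \<in> carrier R; b \<in> carrier R; x \<in> carrier M\<rbrakk>
      \<Longrightarrow> (a \<oplus>\<^bsub>R\<^esub> b) \<odot>\<^bsub>M\<^esub> x = a \<odot>\<^bsub>M\<^esub> x \<oplus>\<^bsub>M\<^esub> b \<odot>\<^bsub>M\<^esub> x"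
    and lsmult_r_distr: "\<lbrakk>a \<in> carrier R; x \<in> carrier M; y \<in> carrier M\<rbrakk>
      \<Longrightarrow> a \<odot>\<^bsub>M\<^esub> (x \<oplus>\<^bsub>M\<^esub> y) = a \<odot>\<^bsub>M\<^esub> x \<oplus>\<^bsub>M\<^esub> a \<odot>\<^bsub>M\<^esub> y"
    and lsmult_assoc: "\<lbrakk>a \<in> carrier R; b \<in> carrier R; x \<in> carrier M\<rbrakk>
      \<Longrightarrow> (a \<otimes>\<^bsub>R\<^esub> b) \<odot>\<^bsub>M\<^esub> x = a \<odot>\<^bsub>M\<^esub> (b \<odot>\<^bsub>M\<^esub> x)"

text \<open>The condition $RM = M$, with $RM$ the additive group generated by all products $am$.
  If \<open>R\<close> has an identity, it says that the identity acts as the identity map.\<close>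

locale full_left_module = left_module R M for R (structure) and M (structure) +
  assumes full: "generate (add_monoid M) {a \<odot>\<^bsub>M\<^esub> x | a x. a \<in> carrier R \<and> x \<in> carrier M} = carrier M"

definition left_module_hom ::
    "('a, 'r) ring_scheme \<Rightarrow> ('a, 'b, 'p) module_scheme \<Rightarrow> ('a, 'c, 'q) module_scheme \<Rightarrow> ('b \<Rightarrow> 'c) set"
  where "left_module_hom R M N = {f \<in> hom (add_monoid M) (add_monoid N).
    \<forall>a\<in>carrier R. \<forall>x\<in>carrier M. f (a \<odot>\<^bsub>M\<^esub> x) = a \<odot>\<^bsub>N\<^esub> f x}"

text \<open>
  Projectivity in the category of modules with $RM = M$, by the lifting property.  A definition
  cannot quantify over types, so the types carrying the test modules are parameters; a statement
  in which they are free type variables ranges over all test modules.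
\<close>

definition projective_left_module ::
    "'m itself \<Rightarrow> 'n itself \<Rightarrow> ('a, 'r) ring_scheme \<Rightarrow> ('a, 'p) module \<Rightarrow> bool"
  where "projective_left_module _ _ R P \<longleftrightarrow> full_left_module R P \<and>
    (\<forall>(M :: ('a, 'm) module) (N :: ('a, 'n) module). \<forall>g f.
       full_left_module R M \<and> full_left_module R N \<and>
       g \<in> left_module_hom R M N \<and> g ` carrier M = carrier N \<and> f \<in> left_module_hom R P N \<longrightarrow>
       (\<exists>h \<in> left_module_hom R P M. \<forall>x\<in>carrier P. g (h x) = f x))"

text \<open>\<open>short_projective_resolution TYPE('m) TYPE('n) R A f B g M\<close>: the sequence
  $0 \to A \to B \to M \to 0$ with maps \<open>f\<close> and \<open>g\<close> is a projective resolution of \<open>M\<close>.\<close>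

definition short_projective_resolution ::
    "'m itself \<Rightarrow> 'n itself \<Rightarrow> ('a, 'r) ring_scheme \<Rightarrow> ('a, 'p) module \<Rightarrow> ('p \<Rightarrow> 'q) \<Rightarrow>
     ('a, 'q) module \<Rightarrow> ('q \<Rightarrow> 's) \<Rightarrow> ('a, 's) module \<Rightarrow> bool"
  where "short_projective_resolution TM TN R A f B g M \<longleftrightarrow>
    projective_left_module TM TN R A \<and> projective_left_module TM TN R B \<and> full_left_module R M \<and>
    f \<in> left_module_hom R A B \<and> g \<in> left_module_hom R B M \<and>
    inj_on f (carrier A) \<and>
    f ` carrier A = kernel (add_monoid B) (add_monoid M) g \<and>
    g ` carrier B = carrier M"

definition left_ideal_module :: "('a, 'r) ring_scheme \<Rightarrow> 'a set \<Rightarrow> ('a, 'a) module"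
  where "left_ideal_module R I = \<lparr>carrier = I, monoid.mult = monoid.mult R, one = one R,
    zero = zero R, add = add R, smult = monoid.mult R\<rparr>"

definition principal_left_ideal :: "('a, 'r) ring_scheme \<Rightarrow> 'a \<Rightarrow> 'a set"
  where "principal_left_ideal R a = (\<lambda>r. r \<otimes>\<^bsub>R\<^esub> a) ` carrier R"

text \<open>The external direct sum of the left ideals $R e_i$, $i < n$; tuples are extended by zero.\<close>

definition idempotent_sum_module :: "('a, 'r) ring_scheme \<Rightarrow> nat \<Rightarrow> (nat \<Rightarrow> 'a) \<Rightarrow> ('a, nat \<Rightarrow> 'a) module"
  where "idempotent_sum_module R n e = \<lparr>
    carrier = {x. (\<forall>i<n. x i \<in> principal_left_ideal R (e i)) \<and> (\<forall>i\<ge>n. x i = \<zero>\<^bsub>R\<^esub>)},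
    monoid.mult = (\<lambda>_ _ _. \<zero>\<^bsub>R\<^esub>), one = (\<lambda>_. \<zero>\<^bsub>R\<^esub>),
    zero = (\<lambda>_. \<zero>\<^bsub>R\<^esub>), add = (\<lambda>x y i. x i \<oplus>\<^bsub>R\<^esub> y i), smult = (\<lambda>a x i. a \<otimes>\<^bsub>R\<^esub> x i)\<rparr>"

definition finitely_generated_submodule ::
    "('a, 'r) ring_scheme \<Rightarrow> ('a, 'b, 'p) module_scheme \<Rightarrow> 'b set \<Rightarrow> bool"
  where "finitely_generated_submodule R M N \<longleftrightarrow> submodule N R M \<and>
    (\<exists>S. finite S \<and> S \<subseteq> N \<and> (\<forall>N'. submodule N' R M \<and> S \<subseteq> N' \<longrightarrow> N \<subseteq> N'))"

text \<open>
  Over a ring with local units, finite direct sums of modules $Re$ with \<open>e\<close> idempotent take the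
  role of the finitely generated free modules: \<open>R\<close> itself need not be finitely generated.
  Over a ring with identity this is the usual notion, since then $Re$ is the quotient of \<open>R\<close>
  by the left ideal $R(1-e)$.
\<close>

definition finitely_presented ::
    "('a, 'r) ring_scheme \<Rightarrow> ('a, 'b, 'p) module_scheme \<Rightarrow> bool"
  where "finitely_presented R M \<longleftrightarrow> full_left_module R M \<and>
    (\<exists>n e. (\<forall>i<n. e i \<in> carrier R \<and> e i \<otimes>\<^bsub>R\<^esub> e i = e i) \<and>
      (let F = idempotent_sum_module R n e in
       \<exists>f \<in> left_module_hom R F M. f ` carrier F = carrier M \<and>
         finitely_generated_submodule R F (kernel (add_monoid F) (add_monoid M) f)))"


section \<open>Free associative algebras\<close>

text \<open>The free monoid gets its own type, written additively, so that the convolution product of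
  \<^theory>\<open>HOL-Library.Poly_Mapping\<close> is the multiplication of the free algebra.\<close>

datatype 'x free_monoid = Word (letters: "'x list")

instantiation free_monoid :: (type) monoid_add
begin

definition "0 = Word []"

definition "u + w = Word (letters u @ letters w)"

instance
  by intro_classes (simp_all add: zero_free_monoid_def plus_free_monoid_def)

end

definition free_algebra :: "'k::field itself \<Rightarrow> 'x set \<Rightarrow> ('x free_monoid \<Rightarrow>\<^sub>0 'k) ring"
  where "free_algebra _ X = \<lparr>carrier = {p. \<forall>w\<in>Poly_Mapping.keys p. set (letters w) \<subseteq> X},
    monoid.mult = (*), one = 1, zero = 0, add = (+)\<rparr>"

definition gen :: "'x \<Rightarrow> ('x free_monoid \<Rightarrow>\<^sub>0 'k::field)"
  where "gen x = Poly_Mapping.single (Word [x]) 1"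


section \<open>Paths\<close>

text \<open>Directed graphs are those of \<^locale>\<open>wf_digraph\<close>, with source map \<^const>\<open>tail\<close> and range map
  \<^const>\<open>head\<close>; multiple edges and loops are allowed and no finiteness is assumed.\<close>

definition simple_closed_path :: "('v, 'e) pre_digraph \<Rightarrow> 'e list \<Rightarrow> bool"
  where "simple_closed_path G c \<longleftrightarrow> wf_digraph.closed_w G c \<and>
    \<not> (\<exists>b m. wf_digraph.closed_w G b \<and> 2 \<le> m \<and> c = concat (replicate m b))"

definition infinite_path :: "('v, 'e) pre_digraph \<Rightarrow> 'e stream \<Rightarrow> bool"
  where "infinite_path G p \<longleftrightarrow>
    (\<forall>i. p !! i \<in> arcs G \<and> head G (p !! i) = tail G (p !! Suc i))"

definition tail_equivalent :: "'e stream \<Rightarrow> 'e stream \<Rightarrow> bool"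
  where "tail_equivalent p q \<longleftrightarrow> (\<exists>m n. sdrop m p = sdrop n q)"

definition tail_class :: "('v, 'e) pre_digraph \<Rightarrow> 'e stream \<Rightarrow> 'e stream set"
  where "tail_class G p = {q. infinite_path G q \<and> tail_equivalent p q}"


section \<open>Leavitt path algebras\<close>

datatype ('v, 'e) lpa_gen = Vertex 'v | Edge 'e | Ghost 'e

definition lpa_gens :: "('v, 'e) pre_digraph \<Rightarrow> ('v, 'e) lpa_gen set"
  where "lpa_gens G = Vertex ` verts G \<union> Edge ` arcs G \<union> Ghost ` arcs G"

text \<open>The relations, each as the difference of its two sides.\<close>

definition lpa_relations ::
    "'k::field itself \<Rightarrow> ('v, 'e) pre_digraph \<Rightarrow> (('v, 'e) lpa_gen free_monoid \<Rightarrow>\<^sub>0 'k) set"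
  where "lpa_relations _ G =
    {gen (Vertex v) * gen (Vertex u) - (if v = u then gen (Vertex v) else 0) | v u.
       v \<in> verts G \<and> u \<in> verts G} \<union>
    {gen (Vertex (tail G e)) * gen (Edge e) - gen (Edge e) | e. e \<in> arcs G} \<union>
    {gen (Edge e) * gen (Vertex (head G e)) - gen (Edge e) | e. e \<in> arcs G} \<union>
    {gen (Vertex (head G e)) * gen (Ghost e) - gen (Ghost e) | e. e \<in> arcs G} \<union>
    {gen (Ghost e) * gen (Vertex (tail G e)) - gen (Ghost e) | e. e \<in> arcs G} \<union>
    {gen (Ghost e) * gen (Edge e') - (if e = e' then gen (Vertex (head G e)) else 0) | e e'.
       e \<in> arcs G \<and> e' \<in> arcs G} \<union>
    {gen (Vertex v) - (\<Sum>e\<in>out_arcs G v. gen (Edge e) * gen (Ghost e)) | v.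
       v \<in> verts G \<and> out_arcs G v \<noteq> {} \<and> finite (out_arcs G v)}"

definition lpa_ideal ::
    "'k::field itself \<Rightarrow> ('v, 'e) pre_digraph \<Rightarrow> (('v, 'e) lpa_gen free_monoid \<Rightarrow>\<^sub>0 'k) set"
  where "lpa_ideal K G = Idl\<^bsub>free_algebra K (lpa_gens G)\<^esub> (lpa_relations K G)"

definition lpa_class ::
    "('v, 'e) pre_digraph \<Rightarrow> (('v, 'e) lpa_gen free_monoid \<Rightarrow>\<^sub>0 'k::field) \<Rightarrow>
     (('v, 'e) lpa_gen free_monoid \<Rightarrow>\<^sub>0 'k) set"
  where "lpa_class G p = lpa_ideal TYPE('k) G +>\<^bsub>free_algebra TYPE('k) (lpa_gens G)\<^esub> p"

text \<open>
  $L_K(E)$ is presented as an algebra without identity.  The free non-unital algebra consists of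
  the elements of the free unital algebra with zero constant term.  As it contains all relations,
  the ideal they generate in either algebra is the same.  The sum defining \<^const>\<open>one\<close> is the
  identity if there are finitely many vertices; otherwise it is zero by convention.
\<close>

definition leavitt_path_algebra ::
    "'k::field itself \<Rightarrow> ('v, 'e) pre_digraph \<Rightarrow> (('v, 'e) lpa_gen free_monoid \<Rightarrow>\<^sub>0 'k) set ring"
  where "leavitt_path_algebra K G =
    (free_algebra K (lpa_gens G) Quot lpa_ideal K G)
      \<lparr>carrier := {lpa_class G p | p.
          p \<in> carrier (free_algebra K (lpa_gens G)) \<and> Poly_Mapping.lookup p 0 = 0},
       one := lpa_class G (\<Sum>v\<in>verts G. gen (Vertex v))\<rparr>"

definition lpa_vertex ::
    "'k::field itself \<Rightarrow> ('v, 'e) pre_digraph \<Rightarrow> 'v \<Rightarrow> (('v, 'e) lpa_gen free_monoid \<Rightarrow>\<^sub>0 'k) set"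
  where "lpa_vertex _ G v = lpa_class G (gen (Vertex v))"

definition lpa_path ::
    "'k::field itself \<Rightarrow> ('v, 'e) pre_digraph \<Rightarrow> 'e list \<Rightarrow> (('v, 'e) lpa_gen free_monoid \<Rightarrow>\<^sub>0 'k) set"
  where "lpa_path _ G c = lpa_class G (prod_list (map (\<lambda>e. gen (Edge e)) c))"


section \<open>Chen modules\<close>

definition scale :: "'k::field \<Rightarrow> ('b \<Rightarrow>\<^sub>0 'k) \<Rightarrow> ('b \<Rightarrow>\<^sub>0 'k)"
  where "scale a m = Poly_Mapping.map ((*) a) m"

definition linear_extension :: "('b \<Rightarrow> ('c \<Rightarrow>\<^sub>0 'k)) \<Rightarrow> ('b \<Rightarrow>\<^sub>0 'k::field) \<Rightarrow> ('c \<Rightarrow>\<^sub>0 'k)"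
  where "linear_extension f m = (\<Sum>b\<in>Poly_Mapping.keys m. scale (Poly_Mapping.lookup m b) (f b))"

fun gen_action ::
    "('v, 'e) pre_digraph \<Rightarrow> ('v, 'e) lpa_gen \<Rightarrow> 'e stream \<Rightarrow> ('e stream \<Rightarrow>\<^sub>0 'k::field)"
  where
    "gen_action G (Vertex v) q =
       (if v = tail G (shd q) then Poly_Mapping.single q 1 else 0)"
  | "gen_action G (Edge e) q =
       (if head G e = tail G (shd q) then Poly_Mapping.single (e ## q) 1 else 0)"
  | "gen_action G (Ghost e) q =
       (if e = shd q then Poly_Mapping.single (stl q) 1 else 0)"

definition word_action ::
    "('v, 'e) pre_digraph \<Rightarrow> ('v, 'e) lpa_gen free_monoid \<Rightarrow> ('e stream \<Rightarrow>\<^sub>0 'k::field) \<Rightarrow> ('e stream \<Rightarrow>\<^sub>0 'k)"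
  where "word_action G w m = foldr (\<lambda>x. linear_extension (gen_action G x)) (letters w) m"

definition free_algebra_action ::
    "('v, 'e) pre_digraph \<Rightarrow> (('v, 'e) lpa_gen free_monoid \<Rightarrow>\<^sub>0 'k::field) \<Rightarrow>
     ('e stream \<Rightarrow>\<^sub>0 'k) \<Rightarrow> ('e stream \<Rightarrow>\<^sub>0 'k)"
  where "free_algebra_action G p m = linear_extension (\<lambda>w. word_action G w m) p"

text \<open>The Leavitt path algebra acts through arbitrary representatives in the free algebra: the
  relations annihilate the space, so the choice does not matter.\<close>

definition chen_module ::
    "'k::field itself \<Rightarrow> ('v, 'e) pre_digraph \<Rightarrow> 'e stream \<Rightarrow>
     ((('v, 'e) lpa_gen free_monoid \<Rightarrow>\<^sub>0 'k) set, 'e stream \<Rightarrow>\<^sub>0 'k) module"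
  where "chen_module _ G p = \<lparr>
    carrier = {m. Poly_Mapping.keys m \<subseteq> tail_class G p},
    monoid.mult = (\<lambda>_ _. 0), one = 0, zero = 0, add = (+),
    smult = (\<lambda>r m. free_algebra_action G (SOME a. a \<in> r) m)\<rparr>"

end

theory Submission
  imports Defs
begin

text \<open>
  Both resolutions are instances of one statement about a module $V = Rw$ and elements
  $c \in eRe$ with $e^2 = e$, $ew = cw = w$: it suffices that no nonzero $r$ satisfies $rc = r$, and
  that every $r \in Re$ with $rw = 0$ lies in $R(c - e)$.  It is applied with $e = v$ and with $e = 1$.

  The first condition holds because $L_K(E)$ is $\mathbb{Z}$-graded and $c$ has positive degree.
  For the second, each infinite path in $[c^\infty]$ has the form $\gamma c^\infty$, and since $c$ is
  simple, $\gamma$ is unique up to powers of $c$ at its end.  Thus $\gamma c^\infty \mapsto \gamma v$ is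
  well defined modulo $L_K(E)(c - v)$.  It is $L_K(E)$-linear, which only needs to be checked on
  generators and, by replacing $\gamma$ with $\gamma c$, on paths $\gamma$ of positive length.  As it
  maps $c^\infty$ to $v$, it maps $r c^\infty$ to $rv$ modulo $L_K(E)(c - v)$.
\<close>

section \<open>Cyclic modules with a resolution of length one\<close>

text \<open>The first condition gives injectivity because, for r in Re, r(c - e) = 0 just says rc =
  r. The obstacle is that L_K(E) is given by generators and relations, with no basis at hand, so
  neither condition can be read off from normal forms. For the first one the grading replaces a
  basis: rc = r forces the component of r in degree d to be the one in degree d - |c| times c, so a
  nonzero component would produce infinitely many. For the second one a kernel element is never
  rewritten; it is tested through the map from V back to the algebra. The values of that map only
  make sense modulo a left ideal, so its congruences may be multiplied from the left but not from
  the right. All this is carried out in the free algebra: equations in L_K(E) become membership in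
  \<open>I\<close>, and equations modulo L_K(E)(c - v) become membership in \<open>J\<close>. For e
  = 1 the additional part r(1 - v) of r is absorbed by (1 - v)(c - 1) = -(1 - v), which holds
  because vc = c.\<close>

lemma (in abelian_group) minus_eq_zero_iff:
  "\<lbrakk>x \<in> carrier G; y \<in> carrier G\<rbrakk> \<Longrightarrow> x \<ominus> y = \<zero> \<longleftrightarrow> x = y"
  by (metis a_inv_closed a_minus_def minus_equality minus_minus r_neg)

section \<open>Arithmetic in rings without identity and their left modules\<close>

context nonunital_ring
begin

lemma mult_zero_left: "x \<in> carrier R \<Longrightarrow> \<zero> \<otimes> x = \<zero>"
  using distrib_right[of \<zero> \<zero> x] mult_closed[of \<zero> x] by simp

lemma mult_zero_right: "x \<in> carrier R \<Longrightarrow> x \<otimes> \<zero> = \<zero>"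
  using distrib_left[of \<zero> \<zero> x] mult_closed[of x \<zero>] by simp

lemma mult_minus_right:
  assumes "x \<in> carrier R" "y \<in> carrier R" "z \<in> carrier R"
  shows "x \<otimes> (y \<ominus> z) = x \<otimes> y \<ominus> x \<otimes> z"
proof -
  have "x \<otimes> (\<ominus> z) \<oplus> x \<otimes> z = \<zero>"
    using assms distrib_left[of "\<ominus> z" z x] by (simp add: l_neg mult_zero_right)
  then have "\<ominus> (x \<otimes> z) = x \<otimes> (\<ominus> z)"
    using assms by (intro minus_equality) (auto intro: mult_closed)
  then show ?thesis
    using assms by (simp add: a_minus_def distrib_left)
qed

lemma mult_minus_left:
  assumes "x \<in> carrier R" "y \<in> carrier R" "z \<in> carrier R"
  shows "(y \<ominus> z) \<otimes> x = y \<otimes> x \<ominus> z \<otimes> x"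
proof -
  have "(\<ominus> z) \<otimes> x \<oplus> z \<otimes> x = \<zero>"
    using assms distrib_right[of "\<ominus> z" z x] by (simp add: l_neg mult_zero_left)
  then have "\<ominus> (z \<otimes> x) = (\<ominus> z) \<otimes> x"
    using assms by (intro minus_equality) (auto intro: mult_closed)
  then show ?thesis
    using assms by (simp add: a_minus_def distrib_right)
qed

text \<open>Idempotence replaces the existential x = re by the equation xe = x, so that membership
  can be decided by rewriting.\<close>

lemma principal_left_ideal_iff:
  assumes "e \<in> carrier R" "e \<otimes> e = e"
  shows "x \<in> principal_left_ideal R e \<longleftrightarrow> x \<in> carrier R \<and> x \<otimes> e = x"
  using assms unfolding principal_left_ideal_def
  by (auto simp: mult_closed mult_assoc image_iff) (metis)

end

context left_module
begin

lemma lsmult_zero_left: "x \<in> carrier M \<Longrightarrow> \<zero>\<^bsub>R\<^esub> \<odot>\<^bsub>M\<^esub> x = \<zero>\<^bsub>M\<^esub>"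
  using lsmult_l_distr[of "\<zero>\<^bsub>R\<^esub>" "\<zero>\<^bsub>R\<^esub>" x] lsmult_closed[of "\<zero>\<^bsub>R\<^esub>" x]
  by simp

lemma lsmult_zero_right: "a \<in> carrier R \<Longrightarrow> a \<odot>\<^bsub>M\<^esub> \<zero>\<^bsub>M\<^esub> = \<zero>\<^bsub>M\<^esub>"
  using lsmult_r_distr[of a "\<zero>\<^bsub>M\<^esub>" "\<zero>\<^bsub>M\<^esub>"] lsmult_closed[of a "\<zero>\<^bsub>M\<^esub>"] by simp

lemma lsmult_minus_left:
  assumes "a \<in> carrier R" "b \<in> carrier R" "x \<in> carrier M"
  shows "(a \<ominus>\<^bsub>R\<^esub> b) \<odot>\<^bsub>M\<^esub> x = a \<odot>\<^bsub>M\<^esub> x \<ominus>\<^bsub>M\<^esub> b \<odot>\<^bsub>M\<^esub> x"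
proof -
  have "(\<ominus>\<^bsub>R\<^esub> b) \<odot>\<^bsub>M\<^esub> x \<oplus>\<^bsub>M\<^esub> b \<odot>\<^bsub>M\<^esub> x = \<zero>\<^bsub>M\<^esub>"
    using assms lsmult_l_distr[of "\<ominus>\<^bsub>R\<^esub> b" b x] by (simp add: R.l_neg lsmult_zero_left)
  then have "\<ominus>\<^bsub>M\<^esub> (b \<odot>\<^bsub>M\<^esub> x) = (\<ominus>\<^bsub>R\<^esub> b) \<odot>\<^bsub>M\<^esub> x"
    using assms by (intro M.minus_equality) (auto intro: lsmult_closed)
  then show ?thesis
    using assms by (simp add: a_minus_def lsmult_l_distr)
qed

lemma full_left_moduleI:
  assumes "\<And>x. x \<in> carrier M \<Longrightarrow> \<exists>a\<in>carrier R. \<exists>y\<in>carrier M. x = a \<odot>\<^bsub>M\<^esub> y"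
  shows "full_left_module R M"
proof unfold_locales
  let ?S = "{a \<odot>\<^bsub>M\<^esub> x | a x. a \<in> carrier R \<and> x \<in> carrier M}"
  have "?S \<subseteq> carrier M" by (auto intro: lsmult_closed)
  moreover have "carrier M \<subseteq> ?S" using assms by blast
  ultimately have "?S = carrier M" by (rule equalityI)
  moreover have "generate (add_monoid M) (carrier (add_monoid M)) \<subseteq> carrier (add_monoid M)"
    by (intro group.generate_incl M.a_group) simp
  ultimately show "generate (add_monoid M) ?S = carrier M"
    by (auto intro: generate.incl)
qed

end

lemma left_ideal_module_simps [simp]:
  "carrier (left_ideal_module R I) = I"
  "zero (left_ideal_module R I) = zero R"
  "add (left_ideal_module R I) = add R"
  "smult (left_ideal_module R I) = monoid.mult R"
  by (simp_all add: left_ideal_module_def)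

lemma idempotent_sum_module_simps:
  "carrier (idempotent_sum_module R n e) =
     {x. (\<forall>i<n. x i \<in> principal_left_ideal R (e i)) \<and> (\<forall>i\<ge>n. x i = \<zero>\<^bsub>R\<^esub>)}"
  "zero (idempotent_sum_module R n e) = (\<lambda>_. \<zero>\<^bsub>R\<^esub>)"
  "add (idempotent_sum_module R n e) = (\<lambda>x y i. x i \<oplus>\<^bsub>R\<^esub> y i)"
  "smult (idempotent_sum_module R n e) = (\<lambda>a x i. a \<otimes>\<^bsub>R\<^esub> x i)"
  by (simp_all add: idempotent_sum_module_def)

section \<open>Left ideals generated by an idempotent\<close>

context nonunital_ring
begin

lemma left_module_principal_left_ideal:
  assumes e: "e \<in> carrier R" "e \<otimes> e = e"
  shows "left_module R (left_ideal_module R (principal_left_ideal R e))"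
proof -
  note iff = principal_left_ideal_iff[OF e]
  have "abelian_group (left_ideal_module R (principal_left_ideal R e))"
  proof (rule abelian_groupI, goal_cases)
    case (6 x)
    then have x: "x \<in> carrier R" "x \<otimes> e = x" by (simp_all add: iff)
    have "(\<zero> \<ominus> x) \<otimes> e = \<zero> \<ominus> x"
      using x e by (simp add: mult_minus_left mult_zero_left)
    then show ?case
      using x by (intro bexI[of _ "\<zero> \<ominus> x"]) (simp_all add: iff a_minus_def l_neg)
  qed (use e in \<open>auto simp: iff distrib_right mult_zero_left a_assoc intro: a_comm\<close>)
  then show ?thesis
    by (intro left_module.intro left_module_axioms.intro nonunital_ring_axioms)
       (use e in \<open>auto simp: iff distrib_right distrib_left mult_assoc mult_closed\<close>)
qed

lemma full_principal_left_ideal: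
  assumes e: "e \<in> carrier R" "e \<otimes> e = e"
  shows "full_left_module R (left_ideal_module R (principal_left_ideal R e))"
proof -
  interpret P: left_module R "left_ideal_module R (principal_left_ideal R e)"
    by (rule left_module_principal_left_ideal[OF e])
  show ?thesis
    proof (rule P.full_left_moduleI)
    fix x assume "x \<in> carrier (left_ideal_module R (principal_left_ideal R e))"
    then show "\<exists>a\<in>carrier R. \<exists>y\<in>carrier (left_ideal_module R (principal_left_ideal R e)).
        x = a \<odot>\<^bsub>left_ideal_module R (principal_left_ideal R e)\<^esub> y"
      using e by (intro bexI[of _ x] bexI[of _ e]) (simp_all add: principal_left_ideal_iff)
  qed
qed

text \<open>A lift of \<open>f\<close> along \<open>g\<close> sends \<open>x\<close> to \<open>x\<close> times a preimage of \<open>f e\<close>, since \<open>f x = x \<cdot> f e\<close>.\<close>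

lemma projective_principal_left_ideal:
  assumes e: "e \<in> carrier R" "e \<otimes> e = e"
  shows "projective_left_module TM TN R (left_ideal_module R (principal_left_ideal R e))"
  unfolding projective_left_module_def
proof (intro conjI full_principal_left_ideal[OF e] allI impI)
  note iff = principal_left_ideal_iff[OF e]
  let ?P = "left_ideal_module R (principal_left_ideal R e)"
  fix M :: "('a, 'c) module" and N :: "('a, 'd) module" and g f
  assume *: "full_left_module R M \<and> full_left_module R N \<and>
       g \<in> left_module_hom R M N \<and> g ` carrier M = carrier N \<and> f \<in> left_module_hom R ?P N"
  then interpret M: full_left_module R M by blast
  have g: "g (a \<odot>\<^bsub>M\<^esub> x) = a \<odot>\<^bsub>N\<^esub> g x" if "a \<in> carrier R" "x \<in> carrier M" for a x
    using * that unfolding left_module_hom_def by blast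
  have f: "f (a \<otimes> x) = a \<odot>\<^bsub>N\<^esub> f x" if "a \<in> carrier R" "x \<in> carrier ?P" for a x
    using * that by (simp add: left_module_hom_def)
  have eP: "e \<in> carrier ?P" using e by (simp add: iff)
  moreover have "f \<in> carrier ?P \<rightarrow> carrier N"
    using * by (simp add: left_module_hom_def hom_def)
  ultimately have "f e \<in> g ` carrier M" using * by blast
  then obtain m where m: "m \<in> carrier M" "g m = f e" by (metis imageE)
  let ?h = "\<lambda>x. x \<odot>\<^bsub>M\<^esub> m"
  have h: "?h \<in> left_module_hom R ?P M"
    using m by (auto simp: left_module_hom_def hom_def iff M.lsmult_closed M.lsmult_l_distr M.lsmult_assoc)
  have "g (?h x) = f x" if "x \<in> carrier ?P" for x
  proof -
    have x: "x \<in> carrier R" "x \<otimes> e = x" using that by (simp_all add: iff)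
    then show ?thesis
      using g[OF x(1) m(1)] f[OF x(1) eP] by (simp add: m(2))
  qed
  then show "\<exists>h\<in>left_module_hom R ?P M. \<forall>x\<in>carrier ?P. g (h x) = f x"
    using h by (intro bexI[of _ ?h] ballI)
qed

end

text \<open>The last three assumptions correspond to the three places of exactness:
  \<open>generates\<close> to surjectivity onto V, \<open>annihilator\<close> to the middle term,
  \<open>no_fixed_point\<close> to injectivity on the left.\<close>

locale cyclic_module_resolution = left_module R V
  for R :: "('a, 'b) ring_scheme" (structure) and V :: "('a, 'c) module" (structure) +
  fixes e c w
  assumes e: "e \<in> carrier R" "e \<otimes>\<^bsub>R\<^esub> e = e"
    and c: "c \<in> carrier R" "e \<otimes>\<^bsub>R\<^esub> c = c" "c \<otimes>\<^bsub>R\<^esub> e = c"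
    and w: "w \<in> carrier V" "e \<odot>\<^bsub>V\<^esub> w = w" "c \<odot>\<^bsub>V\<^esub> w = w"
    and generates: "\<And>x. x \<in> carrier V \<Longrightarrow> \<exists>r\<in>carrier R. x = r \<odot>\<^bsub>V\<^esub> w"
    and no_fixed_point: "\<And>r. \<lbrakk>r \<in> carrier R; r \<otimes>\<^bsub>R\<^esub> c = r\<rbrakk> \<Longrightarrow> r = \<zero>\<^bsub>R\<^esub>"
    and annihilator: "\<And>r. \<lbrakk>r \<in> carrier R; r \<otimes>\<^bsub>R\<^esub> e = r; r \<odot>\<^bsub>V\<^esub> w = \<zero>\<^bsub>V\<^esub>\<rbrakk>
      \<Longrightarrow> \<exists>s\<in>carrier R. r = s \<otimes>\<^bsub>R\<^esub> (c \<ominus>\<^bsub>R\<^esub> e)"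
begin

abbreviation "P \<equiv> left_ideal_module R (principal_left_ideal R e)"

lemma diff_closed: "c \<ominus>\<^bsub>R\<^esub> e \<in> carrier R"
  using e c by simp

lemma diff_unit: "e \<otimes>\<^bsub>R\<^esub> (c \<ominus>\<^bsub>R\<^esub> e) = c \<ominus>\<^bsub>R\<^esub> e" "(c \<ominus>\<^bsub>R\<^esub> e) \<otimes>\<^bsub>R\<^esub> e = c \<ominus>\<^bsub>R\<^esub> e"
  using e c by (simp_all add: R.mult_minus_left R.mult_minus_right)

lemma full: "full_left_module R V"
  using generates w by (intro full_left_moduleI) blast

lemma mult_diff_annihilates:
  assumes "r \<in> carrier R"
  shows "(r \<otimes>\<^bsub>R\<^esub> (c \<ominus>\<^bsub>R\<^esub> e)) \<odot>\<^bsub>V\<^esub> w = \<zero>\<^bsub>V\<^esub>"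
proof -
  have "(c \<ominus>\<^bsub>R\<^esub> e) \<odot>\<^bsub>V\<^esub> w = \<zero>\<^bsub>V\<^esub>"
    using e(1) c(1) w by (simp add: lsmult_minus_left M.minus_eq_zero_iff)
  then show ?thesis
    using assms diff_closed w(1) by (simp only: lsmult_assoc lsmult_zero_right)
qed

text \<open>The factor s may be replaced by se, because e is a left unit for c - e.\<close>

lemma annihilator_in_image:
  assumes "r \<in> carrier R" "r \<otimes>\<^bsub>R\<^esub> e = r" "r \<odot>\<^bsub>V\<^esub> w = \<zero>\<^bsub>V\<^esub>"
  shows "\<exists>s\<in>principal_left_ideal R e. r = s \<otimes>\<^bsub>R\<^esub> (c \<ominus>\<^bsub>R\<^esub> e)"
proof -
  obtain s where s: "s \<in> carrier R" "r = s \<otimes>\<^bsub>R\<^esub> (c \<ominus>\<^bsub>R\<^esub> e)"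
    using annihilator[OF assms] by blast
  have "r = (s \<otimes>\<^bsub>R\<^esub> e) \<otimes>\<^bsub>R\<^esub> (c \<ominus>\<^bsub>R\<^esub> e)"
    using s e diff_closed by (simp add: R.mult_assoc diff_unit)
  then show ?thesis
    using s by (auto simp: principal_left_ideal_def)
qed

text \<open>Since ew = w, the elements r and re move w to the same place, so Re already reaches all
  of V.\<close>

lemma orbit_eq_carrier: "(\<lambda>r. r \<odot>\<^bsub>V\<^esub> w) ` carrier P = carrier V"
proof (intro equalityI subsetI)
  fix x assume "x \<in> carrier V"
  then obtain r where r: "r \<in> carrier R" "x = r \<odot>\<^bsub>V\<^esub> w"
    using generates by blast
  then have "x = (r \<otimes>\<^bsub>R\<^esub> e) \<odot>\<^bsub>V\<^esub> w"
    using e w by (simp add: lsmult_assoc)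
  then show "x \<in> (\<lambda>r. r \<odot>\<^bsub>V\<^esub> w) ` carrier P"
    using r by (auto simp: principal_left_ideal_def)
qed (use e w in \<open>auto simp: R.principal_left_ideal_iff lsmult_closed\<close>)

lemma resolution:
  "short_projective_resolution TM TN R P (\<lambda>r. r \<otimes>\<^bsub>R\<^esub> (c \<ominus>\<^bsub>R\<^esub> e)) P (\<lambda>r. r \<odot>\<^bsub>V\<^esub> w) V"
proof -
  note iff = R.principal_left_ideal_iff[OF e]
  let ?d = "c \<ominus>\<^bsub>R\<^esub> e"
  have inj: "r = s"
    if rs: "r \<in> carrier R" "r \<otimes>\<^bsub>R\<^esub> e = r" "s \<in> carrier R" "s \<otimes>\<^bsub>R\<^esub> e = s"
      and eq: "r \<otimes>\<^bsub>R\<^esub> ?d = s \<otimes>\<^bsub>R\<^esub> ?d" for r s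
  proof -
    let ?t = "r \<ominus>\<^bsub>R\<^esub> s"
    have t: "?t \<in> carrier R" "?t \<otimes>\<^bsub>R\<^esub> e = ?t"
      using rs e by (simp_all add: R.mult_minus_left)
    have "?t \<otimes>\<^bsub>R\<^esub> ?d = \<zero>\<^bsub>R\<^esub>"
      using rs eq diff_closed by (simp add: R.mult_minus_left R.mult_closed R.minus_eq_zero_iff)
    \<comment> \<open>As te = t, the product t(c - e) is tc - t.\<close>
    then have "?t \<otimes>\<^bsub>R\<^esub> c \<ominus>\<^bsub>R\<^esub> ?t = \<zero>\<^bsub>R\<^esub>"
      using t c e by (simp add: R.mult_minus_right)
    then have "?t \<otimes>\<^bsub>R\<^esub> c = ?t"
      using t c by (simp add: R.mult_closed R.minus_eq_zero_iff)
    then have "?t = \<zero>\<^bsub>R\<^esub>"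
      using t no_fixed_point by blast
    then show ?thesis using rs by (simp add: R.minus_eq_zero_iff)
  qed
  have img: "(\<lambda>r. r \<otimes>\<^bsub>R\<^esub> ?d) ` carrier P = kernel (add_monoid P) (add_monoid V) (\<lambda>r. r \<odot>\<^bsub>V\<^esub> w)"
  proof (intro equalityI subsetI)
    fix x assume "x \<in> (\<lambda>r. r \<otimes>\<^bsub>R\<^esub> ?d) ` carrier P"
    then obtain r where "r \<in> carrier R" "x = r \<otimes>\<^bsub>R\<^esub> ?d"
      by (auto simp: iff)
    then show "x \<in> kernel (add_monoid P) (add_monoid V) (\<lambda>r. r \<odot>\<^bsub>V\<^esub> w)"
      using e diff_closed
      by (simp add: kernel_def iff mult_diff_annihilates R.mult_closed R.mult_assoc diff_unit)
  next
    fix x assume "x \<in> kernel (add_monoid P) (add_monoid V) (\<lambda>r. r \<odot>\<^bsub>V\<^esub> w)"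
    then show "x \<in> (\<lambda>r. r \<otimes>\<^bsub>R\<^esub> ?d) ` carrier P"
      using annihilator_in_image[of x] by (auto simp: kernel_def iff)
  qed
  show ?thesis
    unfolding short_projective_resolution_def
  proof (intro conjI R.projective_principal_left_ideal e full img orbit_eq_carrier)
    show "(\<lambda>r. r \<otimes>\<^bsub>R\<^esub> ?d) \<in> left_module_hom R P P"
      using diff_closed e
      by (auto simp: left_module_hom_def hom_def iff R.mult_closed R.mult_assoc diff_unit R.distrib_right)
    show "(\<lambda>r. r \<odot>\<^bsub>V\<^esub> w) \<in> left_module_hom R P V"
      using w by (auto simp: left_module_hom_def hom_def iff lsmult_closed lsmult_l_distr lsmult_assoc)
    show "inj_on (\<lambda>r. r \<otimes>\<^bsub>R\<^esub> ?d) (carrier P)"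
      using inj by (auto simp: inj_on_def iff)
  qed
qed

text \<open>One generator and one relation: the kernel of Re -> V is generated by the single element
  c - e.\<close>

lemma presentation: "finitely_presented R V"
proof -
  note iff = R.principal_left_ideal_iff[OF e]
  let ?d = "c \<ominus>\<^bsub>R\<^esub> e"
  define F where "F = idempotent_sum_module R 1 (\<lambda>_. e)"
  define f where "f = (\<lambda>x :: nat \<Rightarrow> 'a. x 0 \<odot>\<^bsub>V\<^esub> w)"
  \<comment> \<open>A direct sum with one summand consists of functions on the naturals that vanish
    from index 1 on; this is the isomorphism from Re to it, along which the structure is
    transported.\<close>
  define emb where "emb = (\<lambda>r (i::nat). if i = 0 then r else \<zero>\<^bsub>R\<^esub>)"
  have car: "carrier F = emb ` principal_left_ideal R e"
  proof (intro equalityI subsetI)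
    fix x assume x: "x \<in> carrier F"
    then have "x = emb (x 0)"
      by (intro ext) (auto simp: F_def emb_def idempotent_sum_module_simps)
    then show "x \<in> emb ` principal_left_ideal R e"
      using x by (auto simp: F_def idempotent_sum_module_simps)
  qed (auto simp: F_def emb_def idempotent_sum_module_simps)
  have emb_F: "emb r \<oplus>\<^bsub>F\<^esub> emb s = emb (r \<oplus>\<^bsub>R\<^esub> s)" "\<zero>\<^bsub>F\<^esub> = emb \<zero>\<^bsub>R\<^esub>" for r s
    by (auto simp: F_def emb_def idempotent_sum_module_simps)
  have emb_smult: "a \<odot>\<^bsub>F\<^esub> emb r = emb (a \<otimes>\<^bsub>R\<^esub> r)" if "a \<in> carrier R" for a r
    using that by (auto simp: F_def emb_def idempotent_sum_module_simps R.mult_zero_right)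
  have f_emb: "f (emb r) = r \<odot>\<^bsub>V\<^esub> w" for r
    by (simp add: f_def emb_def)
  have inj_emb: "inj emb"
    by (rule injI) (metis emb_def)
  interpret P: left_module R P
    by (rule R.left_module_principal_left_ideal[OF e])
  have grp: "abelian_group F"
  proof (rule abelian_groupI, goal_cases)
    case (6 x)
    then obtain r where r: "r \<in> carrier P" "x = emb r" by (auto simp: car)
    obtain s where "s \<in> carrier P" "s \<oplus>\<^bsub>P\<^esub> r = \<zero>\<^bsub>P\<^esub>"
      using r(1) P.M.l_neg P.M.a_inv_closed by blast
    then show ?case
      using r by (auto simp: car emb_F intro!: bexI[of _ s])
  qed (use P.M.a_closed P.M.zero_closed P.M.a_assoc P.M.a_comm P.M.l_zero in \<open>auto simp: car emb_F\<close>)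
  interpret F: abelian_group F by (rule grp)
  have hom: "f \<in> left_module_hom R F V"
    using w by (auto simp: left_module_hom_def hom_def car emb_F emb_smult f_emb iff
        lsmult_closed lsmult_l_distr lsmult_assoc)
  have surj: "f ` carrier F = carrier V"
    using orbit_eq_carrier by (simp add: car image_image f_emb)
  define N where "N = kernel (add_monoid F) (add_monoid V) f"
  have N: "x \<in> N \<longleftrightarrow> x \<in> carrier F \<and> f x = \<zero>\<^bsub>V\<^esub>" for x
    by (auto simp: N_def kernel_def)
  interpret f: group_hom "add_monoid F" "add_monoid V" f
    using hom by (intro group_hom.intro group_hom_axioms.intro F.a_group M.a_group)
      (simp add: left_module_hom_def)
  have smult_F: "a \<odot>\<^bsub>F\<^esub> x \<in> carrier F" if "a \<in> carrier R" "x \<in> carrier F" for a x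
    using that e by (auto simp: car emb_smult iff R.mult_closed R.mult_assoc)
  have sub: "submodule N R F"
  proof (intro submodule.intro submodule_axioms.intro)
    show "subgroup N (add_monoid F)"
      unfolding N_def by (rule f.subgroup_kernel)
    show "a \<odot>\<^bsub>F\<^esub> x \<in> N" if "a \<in> carrier R" "x \<in> N" for a x
      using that hom by (auto simp: N smult_F left_module_hom_def lsmult_zero_right)
  qed
  have "emb ?d \<in> N"
    using diff_closed mult_diff_annihilates[OF e(1)]
    by (auto simp: N car f_emb iff diff_unit)
  moreover have "N \<subseteq> N'" if N': "submodule N' R F" "{emb ?d} \<subseteq> N'" for N'
  proof
    fix x assume "x \<in> N"
    then obtain r where r: "r \<in> carrier R" "r \<otimes>\<^bsub>R\<^esub> e = r" "x = emb r" "r \<odot>\<^bsub>V\<^esub> w = \<zero>\<^bsub>V\<^esub>"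
      by (auto simp: N car f_emb iff)
    then obtain s where s: "s \<in> carrier R" "r = s \<otimes>\<^bsub>R\<^esub> ?d"
      using annihilator by blast
    then have "x = s \<odot>\<^bsub>F\<^esub> emb ?d" by (simp add: emb_smult r)
    then show "x \<in> N'"
      using s(1) N' by (simp add: submodule.smult_closed)
  qed
  ultimately have "finitely_generated_submodule R F N"
    unfolding finitely_generated_submodule_def using sub by (intro conjI exI[of _ "{emb ?d}"]) auto
  then show ?thesis
    unfolding finitely_presented_def Let_def using full hom surj e
    by (intro conjI exI[of _ 1] exI[of _ "\<lambda>_. e"] bexI[of _ f]) (auto simp: F_def N_def)
qed

end

section \<open>Linear extensions and the free algebra\<close>

text \<open>A property closed under sums only has to be checked on monomials. The set S remembers
  which basis elements may occur: admissible words, or paths in the tail class.\<close>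

lemma poly_mapping_induct_single [consumes 1, case_names zero add single]:
  fixes p :: "'b \<Rightarrow>\<^sub>0 'k::comm_monoid_add"
  assumes "Poly_Mapping.keys p \<subseteq> S" and "Q 0"
    and "\<And>p q. Q p \<Longrightarrow> Q q \<Longrightarrow> Q (p + q)"
    and "\<And>b a. b \<in> S \<Longrightarrow> Q (Poly_Mapping.single b a)"
  shows "Q p"
proof -
  \<comment> \<open>Partial sums over subsets of the support, so that membership in S is available
    for each term.\<close>
  have "Q (\<Sum>b\<in>B. Poly_Mapping.single b (Poly_Mapping.lookup p b))"
    if "finite B" "B \<subseteq> Poly_Mapping.keys p" for B
    using that by (induction B) (use assms in auto)
  moreover have "p = (\<Sum>b\<in>Poly_Mapping.keys p. Poly_Mapping.single b (Poly_Mapping.lookup p b))"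
    by (rule poly_mapping_eqI)
      (simp add: lookup_sum lookup_single when_def sum.delta' in_keys_iff)
  ultimately show ?thesis by (metis finite_keys order_refl)
qed

section \<open>Scaling and linear extension\<close>

lemma lookup_scale: "Poly_Mapping.lookup (scale a m) b = a * Poly_Mapping.lookup m b"
  by (simp add: scale_def Poly_Mapping.map.rep_eq when_def)

lemma scale_simps [simp]:
  "scale 0 m = 0" "scale a 0 = 0" "scale 1 m = m" "scale a (scale b m) = scale (a * b) m"
  "scale a (Poly_Mapping.single x b) = Poly_Mapping.single x (a * b)"
  by (rule poly_mapping_eqI; simp add: lookup_scale lookup_single when_def)+

lemma scale_add_right: "scale a (m + n) = scale a m + scale a n"
  and scale_add_left: "scale (a + b) m = scale a m + scale b m"
  by (rule poly_mapping_eqI; simp add: lookup_scale lookup_add algebra_simps)+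

lemma scale_sum: "scale a (sum f B) = (\<Sum>b\<in>B. scale a (f b))"
  by (rule poly_mapping_eqI) (simp add: lookup_scale lookup_sum sum_distrib_left)

text \<open>Cancellation can make the support of a sum smaller than the union of the supports.
  Additivity therefore needs one common index set for all the sums involved.\<close>

lemma linear_extension_superset:
  assumes "finite B" "Poly_Mapping.keys m \<subseteq> B"
  shows "linear_extension f m = (\<Sum>b\<in>B. scale (Poly_Mapping.lookup m b) (f b))"
  unfolding linear_extension_def by (rule sum.mono_neutral_left) (use assms in \<open>auto simp: in_keys_iff\<close>)

lemma linear_extension_zero [simp]: "linear_extension f 0 = 0"
  by (simp add: linear_extension_def)

lemma linear_extension_add: "linear_extension f (m + n) = linear_extension f m + linear_extension f n"
proof -
  let ?B = "Poly_Mapping.keys m \<union> Poly_Mapping.keys n"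
  have "Poly_Mapping.keys (m + n) \<subseteq> ?B" by (rule keys_add)
  then show ?thesis
    by (simp add: linear_extension_superset[of ?B] lookup_add scale_add_left sum.distrib)
qed

lemma linear_extension_single [simp]: "linear_extension f (Poly_Mapping.single b a) = scale a (f b)"
  by (simp add: linear_extension_superset[of "{b}"])

lemma linear_extension_scale: "linear_extension f (scale a m) = scale a (linear_extension f m)"
proof -
  have "Poly_Mapping.keys (scale a m) \<subseteq> Poly_Mapping.keys m"
    by (auto simp: in_keys_iff lookup_scale)
  then show ?thesis
    by (simp add: linear_extension_superset[of "Poly_Mapping.keys m"] lookup_scale scale_sum)
qed

lemma linear_extension_minus: "linear_extension f (m - n) = linear_extension f m - linear_extension f n"
  using linear_extension_add[of f "m - n" n] by simp

lemma linear_extension_sum: "linear_extension f (sum g B) = (\<Sum>b\<in>B. linear_extension f (g b))"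
  by (induction B rule: infinite_finite_induct) (simp_all add: linear_extension_add)

lemma keys_linear_extension:
  assumes "Poly_Mapping.keys m \<subseteq> S" "\<And>b. b \<in> S \<Longrightarrow> Poly_Mapping.keys (f b) \<subseteq> T"
  shows "Poly_Mapping.keys (linear_extension f m) \<subseteq> T"
  using assms(1)
proof (induction m rule: poly_mapping_induct_single)
  case (add p q)
  then show ?case using keys_add by (fastforce simp: linear_extension_add)
next
  case (single b a)
  have "Poly_Mapping.keys (scale a (f b)) \<subseteq> Poly_Mapping.keys (f b)"
    by (auto simp: in_keys_iff lookup_scale)
  then show ?case using assms(2)[OF single] by simp
qed simp

text \<open>Scalars are multiples of the empty word, so a left ideal is automatically a
  subspace.\<close>

lemma scale_eq_mult: "scale a p = Poly_Mapping.single 0 a * p"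
  unfolding scale_def by (rule mult_map_scale_conv_mult)

lemma mult_scale_right:
  fixes p q :: "'x::monoid_add \<Rightarrow>\<^sub>0 'k::field"
  shows "p * scale a q = scale a (p * q)"
proof -
  have "Poly_Mapping.keys p \<subseteq> UNIV" by simp
  then show ?thesis
    by (induction p rule: poly_mapping_induct_single)
       (simp_all add: scale_eq_mult distrib_left distrib_right mult_single mult.commute flip: mult.assoc)
qed

lemma mult_scale_left:
  fixes p q :: "'x::monoid_add \<Rightarrow>\<^sub>0 'k::field"
  shows "scale a p * q = scale a (p * q)"
  by (simp add: scale_eq_mult mult.assoc)

section \<open>The action of the free algebra on combinations of streams\<close>

lemma word_action_zero: "word_action G 0 m = m"
  by (simp add: word_action_def zero_free_monoid_def)

lemma word_action_plus: "word_action G (u + w) m = word_action G u (word_action G w m)"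
  by (simp add: word_action_def plus_free_monoid_def)

lemma word_action_letter: "word_action G (Word [x]) m = linear_extension (gen_action G x) m"
  by (simp add: word_action_def)

lemma word_action_linear:
  "word_action G w 0 = 0"
  "word_action G w (m + n) = word_action G w m + word_action G w n"
  "word_action G w (scale a m) = scale a (word_action G w m)"
proof -
  have "foldr (\<lambda>x. linear_extension (gen_action G x)) xs 0 = 0"
    "foldr (\<lambda>x. linear_extension (gen_action G x)) xs (m + n) =
     foldr (\<lambda>x. linear_extension (gen_action G x)) xs m + foldr (\<lambda>x. linear_extension (gen_action G x)) xs n"
    "foldr (\<lambda>x. linear_extension (gen_action G x)) xs (scale a m) =
     scale a (foldr (\<lambda>x. linear_extension (gen_action G x)) xs m)" for xs
    by (induction xs) (simp_all add: linear_extension_add linear_extension_scale)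
  then show "word_action G w 0 = 0"
    "word_action G w (m + n) = word_action G w m + word_action G w n"
    "word_action G w (scale a m) = scale a (word_action G w m)"
    by (simp_all add: word_action_def)
qed

lemma action_single: "free_algebra_action G (Poly_Mapping.single w a) m = scale a (word_action G w m)"
  by (simp add: free_algebra_action_def)

lemma action_gen: "free_algebra_action G (gen x) m = linear_extension (gen_action G x) m"
  by (simp add: gen_def action_single word_action_letter)

lemma action_one: "free_algebra_action G 1 m = m"
  using action_single[of G 0 1 m] by (simp add: word_action_zero)

lemma action_add_left: "free_algebra_action G (p + q) m = free_algebra_action G p m + free_algebra_action G q m"
  and action_minus_left: "free_algebra_action G (p - q) m = free_algebra_action G p m - free_algebra_action G q m"
  and action_scale_left: "free_algebra_action G (scale a p) m = scale a (free_algebra_action G p m)"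
  and action_zero_left: "free_algebra_action G 0 m = 0"
  and action_sum_left: "free_algebra_action G (sum h B) m = (\<Sum>b\<in>B. free_algebra_action G (h b) m)"
  by (simp_all add: free_algebra_action_def linear_extension_add linear_extension_minus linear_extension_scale linear_extension_sum)

lemma action_linear_right:
  "free_algebra_action G p 0 = 0"
  "free_algebra_action G p (m + n) = free_algebra_action G p m + free_algebra_action G p n"
  "free_algebra_action G p (scale a m) = scale a (free_algebra_action G p m)"
proof -
  have "Poly_Mapping.keys p \<subseteq> UNIV" by simp
  then have "free_algebra_action G p 0 = 0 \<and>
    free_algebra_action G p (m + n) = free_algebra_action G p m + free_algebra_action G p n \<and>
    free_algebra_action G p (scale a m) = scale a (free_algebra_action G p m)"
    by (induction p rule: poly_mapping_induct_single)
       (simp_all add: action_zero_left action_add_left action_single word_action_linear scale_add_right mult.commute)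
  then show "free_algebra_action G p 0 = 0"
    "free_algebra_action G p (m + n) = free_algebra_action G p m + free_algebra_action G p n"
    "free_algebra_action G p (scale a m) = scale a (free_algebra_action G p m)" by blast+
qed

lemma action_mult: "free_algebra_action G (p * q) m = free_algebra_action G p (free_algebra_action G q m)"
proof -
  have "Poly_Mapping.keys p \<subseteq> UNIV" by simp
  then show ?thesis
  proof (induction p rule: poly_mapping_induct_single)
    case (single u a)
    have "Poly_Mapping.keys q \<subseteq> UNIV" by simp
    then show ?case
      by (induction q rule: poly_mapping_induct_single)
         (simp_all add: action_zero_left action_add_left action_single word_action_linear mult_single
           word_action_plus distrib_left scale_add_right)
  qed (simp_all add: action_zero_left action_add_left distrib_right)
qed

text \<open>A product of words is empty only if both factors are; for this reason the elements
  without constant term form an ideal (\<open>A0_closed\<close>).\<close>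

lemma free_monoid_sum_zero: "0 = (u :: 'x free_monoid) + w \<longleftrightarrow> u = 0 \<and> w = 0"
  by (cases u; cases w) (auto simp: zero_free_monoid_def plus_free_monoid_def)

lemma gen_mult_gen: "gen x * gen y = Poly_Mapping.single (Word [x, y]) 1"
  by (simp add: gen_def mult_single plus_free_monoid_def)

lemma single_Word_Cons: "Poly_Mapping.single (Word (x # xs)) a = gen x * Poly_Mapping.single (Word xs) a"
  by (simp add: gen_def mult_single plus_free_monoid_def)

lemma single_Word_snoc: "Poly_Mapping.single (Word (xs @ [x])) a = Poly_Mapping.single (Word xs) a * gen x"
  by (simp add: gen_def mult_single plus_free_monoid_def)

lemma lpa_gens_simps [simp]:
  "Vertex v \<in> lpa_gens G \<longleftrightarrow> v \<in> verts G"
  "Edge e \<in> lpa_gens G \<longleftrightarrow> e \<in> arcs G"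
  "Ghost e \<in> lpa_gens G \<longleftrightarrow> e \<in> arcs G"
  by (auto simp: lpa_gens_def)

section \<open>Ring structure and ideals of the free algebra\<close>

lemma free_algebra_simps [simp]:
  "monoid.mult (free_algebra K X) = (*)" "one (free_algebra K X) = 1"
  "zero (free_algebra K X) = 0" "add (free_algebra K X) = (+)"
  by (simp_all add: free_algebra_def)

lemma carrier_free_algebra:
  "p \<in> carrier (free_algebra K X) \<longleftrightarrow> Poly_Mapping.keys p \<subseteq> {w. set (letters w) \<subseteq> X}"
  by (auto simp: free_algebra_def)

lemma free_algebra_closed:
  "0 \<in> carrier (free_algebra K X)" "1 \<in> carrier (free_algebra K X)"
  "p \<in> carrier (free_algebra K X) \<Longrightarrow> q \<in> carrier (free_algebra K X) \<Longrightarrow> p + q \<in> carrier (free_algebra K X)"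
  "p \<in> carrier (free_algebra K X) \<Longrightarrow> - p \<in> carrier (free_algebra K X)"
  "p \<in> carrier (free_algebra K X) \<Longrightarrow> q \<in> carrier (free_algebra K X) \<Longrightarrow> p - q \<in> carrier (free_algebra K X)"
  "p \<in> carrier (free_algebra K X) \<Longrightarrow> q \<in> carrier (free_algebra K X) \<Longrightarrow> p * q \<in> carrier (free_algebra K X)"
  "set (letters w) \<subseteq> X \<Longrightarrow> Poly_Mapping.single w a \<in> carrier (free_algebra K X)"
  "x \<in> X \<Longrightarrow> gen x \<in> carrier (free_algebra K X)"
proof -
  show 1: "p + q \<in> carrier (free_algebra K X)"
    if "p \<in> carrier (free_algebra K X)" "q \<in> carrier (free_algebra K X)" for p q
    using that keys_add[of p q] by (auto simp: carrier_free_algebra)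
  show 2: "- p \<in> carrier (free_algebra K X)" if "p \<in> carrier (free_algebra K X)" for p
    using that by (auto simp: carrier_free_algebra in_keys_iff subset_iff)
  show "p - q \<in> carrier (free_algebra K X)"
    if "p \<in> carrier (free_algebra K X)" "q \<in> carrier (free_algebra K X)"
    using 1[OF that(1) 2[OF that(2)]] by simp
  show "p * q \<in> carrier (free_algebra K X)"
    if "p \<in> carrier (free_algebra K X)" "q \<in> carrier (free_algebra K X)"
    using that keys_mult[of p q] by (fastforce simp: carrier_free_algebra plus_free_monoid_def)
qed (auto simp: carrier_free_algebra zero_free_monoid_def gen_def single_one[symmetric] simp del: single_one)

lemma free_algebra_sum_closed:
  "(\<And>b. b \<in> B \<Longrightarrow> h b \<in> carrier (free_algebra K X)) \<Longrightarrow> sum h B \<in> carrier (free_algebra K X)"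
  by (induction B rule: infinite_finite_induct) (auto intro: free_algebra_closed)

lemma ring_free_algebra: "ring (free_algebra K X)"
proof (rule ringI)
  show "abelian_group (free_algebra K X)"
    by (rule abelian_groupI) (auto intro: free_algebra_closed bexI[of _ "- _"])
  show "Group.monoid (free_algebra K X)"
    by (rule monoidI) (auto intro: free_algebra_closed simp: mult.assoc)
qed (auto simp: distrib_left distrib_right)

lemma free_algebra_ideal_minus: "ideal I (free_algebra K X) \<Longrightarrow> p \<in> I \<Longrightarrow> - p \<in> I"
  using ideal.I_l_closed[of I "free_algebra K X" p "- 1"] by (simp add: free_algebra_closed)

text \<open>Multiplication by monomials suffices, since every element is a sum of them; negation is
  multiplication by -1 at the empty word. The criterion is shaped for
  \<open>I_induct\<close>.\<close>

lemma free_algebra_idealI: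
  assumes "S \<subseteq> carrier (free_algebra K X)" "0 \<in> S" "\<And>p q. p \<in> S \<Longrightarrow> q \<in> S \<Longrightarrow> p + q \<in> S"
    and left: "\<And>w a p. set (letters w) \<subseteq> X \<Longrightarrow> p \<in> S \<Longrightarrow> Poly_Mapping.single w a * p \<in> S"
    and right: "\<And>w a p. set (letters w) \<subseteq> X \<Longrightarrow> p \<in> S \<Longrightarrow> p * Poly_Mapping.single w a \<in> S"
  shows "ideal S (free_algebra K X)"
proof (rule idealI[OF ring_free_algebra])
  have minus: "- p \<in> S" if "p \<in> S" for p
  proof -
    have "set (letters 0) \<subseteq> X" by (simp add: zero_free_monoid_def)
    then show ?thesis using left[of 0 p "- 1"] that by (simp add: single_uminus)
  qed
  have inv: "inv\<^bsub>add_monoid (free_algebra K X)\<^esub> p = - p" if "p \<in> S" for p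
    unfolding a_inv_def[symmetric]
    by (rule abelian_group.minus_equality[OF ring.is_abelian_group[OF ring_free_algebra]])
       (use that assms(1) in \<open>auto simp: free_algebra_closed\<close>)
  show "subgroup S (add_monoid (free_algebra K X))"
    by (rule subgroup.intro) (use assms minus inv in auto)
  fix p x assume p: "p \<in> S" and "x \<in> carrier (free_algebra K X)"
  then have "Poly_Mapping.keys x \<subseteq> {w. set (letters w) \<subseteq> X}" by (simp add: carrier_free_algebra)
  then have "x * p \<in> S \<and> p * x \<in> S"
    by (induction x rule: poly_mapping_induct_single)
       (use assms p in \<open>auto simp: distrib_left distrib_right\<close>)
  then show "x \<otimes>\<^bsub>free_algebra K X\<^esub> p \<in> S" "p \<otimes>\<^bsub>free_algebra K X\<^esub> x \<in> S" by simp_all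
qed

section \<open>The ring structure of a Leavitt path algebra\<close>

locale leavitt =
  fixes G :: "('v, 'e) pre_digraph" and K :: "'k::field itself"
  assumes wf: "wf_digraph G"
begin

abbreviation "A \<equiv> free_algebra K (lpa_gens G)"
abbreviation "I \<equiv> lpa_ideal K G"
abbreviation "L \<equiv> leavitt_path_algebra K G"
abbreviation "words \<equiv> {w. set (letters w) \<subseteq> lpa_gens G}"

lemmas tail_head [simp] = wf_digraph.tail_in_verts[OF wf] wf_digraph.head_in_verts[OF wf]

lemma relations_subset: "lpa_relations K G \<subseteq> carrier A"
  unfolding lpa_relations_def
  by (auto intro!: free_algebra_closed(5,6) free_algebra_sum_closed intro: free_algebra_closed(1,8))

lemma ideal_I: "ideal I A"
  unfolding lpa_ideal_def by (rule ring.genideal_ideal[OF ring_free_algebra relations_subset])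

sublocale I: ideal I A by (rule ideal_I)

lemma relations_in_I: "r \<in> lpa_relations K G \<Longrightarrow> r \<in> I"
  unfolding lpa_ideal_def using ring.genideal_self[OF ring_free_algebra relations_subset] by blast

lemma I_subset: "p \<in> I \<Longrightarrow> p \<in> carrier A"
  by (rule I.Icarr)

lemma I_closed:
  "0 \<in> I" "p \<in> I \<Longrightarrow> q \<in> I \<Longrightarrow> p + q \<in> I" "p \<in> I \<Longrightarrow> - p \<in> I" "p \<in> I \<Longrightarrow> q \<in> I \<Longrightarrow> p - q \<in> I"
  "a \<in> carrier A \<Longrightarrow> p \<in> I \<Longrightarrow> a * p \<in> I" "a \<in> carrier A \<Longrightarrow> p \<in> I \<Longrightarrow> p * a \<in> I"
proof -
  show "0 \<in> I" using additive_subgroup.zero_closed[OF ideal.axioms(1)[OF ideal_I]] by simp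
  show 1: "p \<in> I \<Longrightarrow> q \<in> I \<Longrightarrow> p + q \<in> I" for p q using additive_subgroup.a_closed[OF ideal.axioms(1)[OF ideal_I], of p q] by simp
  show 2: "p \<in> I \<Longrightarrow> - p \<in> I" for p by (rule free_algebra_ideal_minus[OF ideal_I])
  show "p \<in> I \<Longrightarrow> q \<in> I \<Longrightarrow> p - q \<in> I" using 1[of p "- q"] 2[of q] by simp
  show "a \<in> carrier A \<Longrightarrow> p \<in> I \<Longrightarrow> a * p \<in> I" using I.I_l_closed[of p a] by simp
  show "a \<in> carrier A \<Longrightarrow> p \<in> I \<Longrightarrow> p * a \<in> I" using I.I_r_closed[of p a] by simp
qed

text \<open>I is the smallest ideal containing the relations, and the elements with property Q form
  an ideal. Only monomials occur as factors, which keeps track of degrees easy.\<close>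

lemma I_induct [consumes 1, case_names relation zero add left right]:
  assumes "p \<in> I"
    and "\<And>r. r \<in> lpa_relations K G \<Longrightarrow> Q r" "Q 0"
    and "\<And>p q. p \<in> carrier A \<Longrightarrow> q \<in> carrier A \<Longrightarrow> Q p \<Longrightarrow> Q q \<Longrightarrow> Q (p + q)"
    and "\<And>w a p. w \<in> words \<Longrightarrow> p \<in> carrier A \<Longrightarrow> Q p \<Longrightarrow> Q (Poly_Mapping.single w a * p)"
    and "\<And>w a p. w \<in> words \<Longrightarrow> p \<in> carrier A \<Longrightarrow> Q p \<Longrightarrow> Q (p * Poly_Mapping.single w a)"
  shows "Q p"
proof -
  have "ideal {p \<in> carrier A. Q p} A"
    by (rule free_algebra_idealI) (use assms(2-) in \<open>auto intro: free_algebra_closed\<close>)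
  then have "I \<subseteq> {p \<in> carrier A. Q p}"
    unfolding lpa_ideal_def
    using assms(2) relations_subset by (intro ring.genideal_minimal[OF ring_free_algebra]) auto
  then show ?thesis using assms(1) by blast
qed

text \<open>\<open>lpa_class\<close> is built with \<open>TYPE('k)\<close>, the ideal of the locale
  with \<open>K\<close>; these arguments only fix the type of the scalars, so both cosets agree
  after unfolding.\<close>

lemma class_eq: "lpa_class G p = I +>\<^bsub>A\<^esub> (p :: ('v, 'e) lpa_gen free_monoid \<Rightarrow>\<^sub>0 'k)"
  by (simp add: lpa_class_def lpa_ideal_def free_algebra_def lpa_relations_def)

lemma class_image: "lpa_class G p = (\<lambda>i. i + p) ` I"
  unfolding class_eq a_r_coset_def r_coset_def by auto

text \<open>This moves every equation in L to the free algebra, where the arithmetic of type classes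
  is available.\<close>

lemma class_eq_iff: "lpa_class G p = lpa_class G q \<longleftrightarrow> p - q \<in> I"
proof
  assume "lpa_class G p = lpa_class G q"
  moreover have "0 + p \<in> lpa_class G p" unfolding class_image using I_closed(1) by blast
  ultimately show "p - q \<in> I" by (auto simp: class_image)
next
  assume *: "p - q \<in> I"
  have "i + p \<in> lpa_class G q" "i + q \<in> lpa_class G p" if "i \<in> I" for i
  proof -
    have "i + p = (i + (p - q)) + q" "i + q = (i - (p - q)) + p" by simp_all
    then show "i + p \<in> lpa_class G q" "i + q \<in> lpa_class G p"
      using I_closed(2,4)[OF that *] unfolding class_image by (metis imageI)+
  qed
  then show "lpa_class G p = lpa_class G q"
    unfolding class_image[of p] class_image[of q] by auto
qed

text \<open>The augmentation ideal of A, that is, the free algebra without identity. Representatives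
  are taken from it because the class of 1 need not belong to L.\<close>

definition A0 :: "(('v, 'e) lpa_gen free_monoid \<Rightarrow>\<^sub>0 'k) set"
  where "A0 = {p \<in> carrier A. Poly_Mapping.lookup p 0 = 0}"

lemma A0_subset: "p \<in> A0 \<Longrightarrow> p \<in> carrier A"
  by (simp add: A0_def)

lemma A0_closed:
  "0 \<in> A0" "p \<in> A0 \<Longrightarrow> q \<in> A0 \<Longrightarrow> p + q \<in> A0" "p \<in> A0 \<Longrightarrow> - p \<in> A0" "p \<in> A0 \<Longrightarrow> q \<in> A0 \<Longrightarrow> p - q \<in> A0"
  "a \<in> carrier A \<Longrightarrow> p \<in> A0 \<Longrightarrow> a * p \<in> A0" "a \<in> carrier A \<Longrightarrow> p \<in> A0 \<Longrightarrow> p * a \<in> A0"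
  "x \<in> lpa_gens G \<Longrightarrow> gen x \<in> A0"
proof -
  have "0 \<notin> Poly_Mapping.keys (p * q)"
    if "0 \<notin> Poly_Mapping.keys p \<or> 0 \<notin> Poly_Mapping.keys q"
    for p q :: "('v, 'e) lpa_gen free_monoid \<Rightarrow>\<^sub>0 'k"
    using that keys_mult[of p q] by (auto dest!: subsetD simp: free_monoid_sum_zero)
  then show "a \<in> carrier A \<Longrightarrow> p \<in> A0 \<Longrightarrow> a * p \<in> A0" "a \<in> carrier A \<Longrightarrow> p \<in> A0 \<Longrightarrow> p * a \<in> A0"
    by (auto simp: A0_def free_algebra_closed in_keys_iff)
qed (auto simp: A0_def free_algebra_closed lookup_add lookup_minus gen_def lookup_single zero_free_monoid_def when_def)

lemma A0_sum: "(\<And>b. b \<in> B \<Longrightarrow> h b \<in> A0) \<Longrightarrow> sum h B \<in> A0"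
  by (induction B rule: infinite_finite_induct) (auto intro: A0_closed)

lemma carrier_L: "carrier L = lpa_class G ` A0"
  by (auto simp: leavitt_path_algebra_def A0_def carrier_free_algebra)

lemma zero_L: "\<zero>\<^bsub>L\<^esub> = lpa_class G 0"
  by (simp add: leavitt_path_algebra_def FactRing_def class_image)

lemma one_L: "\<one>\<^bsub>L\<^esub> = lpa_class G (\<Sum>v\<in>verts G. gen (Vertex v))"
  by (simp add: leavitt_path_algebra_def)

lemma add_L: "p \<in> A0 \<Longrightarrow> q \<in> A0 \<Longrightarrow> lpa_class G p \<oplus>\<^bsub>L\<^esub> lpa_class G q = lpa_class G (p + q)"
  using I.a_rcos_sum[of p q] by (simp add: leavitt_path_algebra_def FactRing_def class_eq A0_subset)

lemma mult_L: "p \<in> A0 \<Longrightarrow> q \<in> A0 \<Longrightarrow> lpa_class G p \<otimes>\<^bsub>L\<^esub> lpa_class G q = lpa_class G (p * q)"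
  using I.rcoset_mult_add[of p q] by (simp add: leavitt_path_algebra_def FactRing_def class_eq A0_subset)

sublocale L: nonunital_ring L
proof (intro nonunital_ring.intro nonunital_ring_axioms.intro)
  show "abelian_group L"
  proof (rule abelian_groupI, goal_cases)
    case (6 x)
    then obtain p where "p \<in> A0" "x = lpa_class G p" by (auto simp: carrier_L)
    then show ?case
      by (intro bexI[of _ "lpa_class G (- p)"]) (auto simp: carrier_L add_L zero_L A0_closed)
  qed (auto simp: carrier_L zero_L add_L A0_closed add_ac)
qed (auto simp: carrier_L add_L mult_L A0_closed A0_subset mult.assoc distrib_left distrib_right)

lemma minus_L:
  assumes "p \<in> A0" "q \<in> A0"
  shows "lpa_class G p \<ominus>\<^bsub>L\<^esub> lpa_class G q = lpa_class G (p - q)"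
proof -
  have "\<ominus>\<^bsub>L\<^esub> lpa_class G q = lpa_class G (- q)"
    using assms by (intro L.minus_equality) (auto simp: carrier_L zero_L add_L A0_closed)
  then show ?thesis
    using assms by (simp add: a_minus_def add_L A0_closed)
qed

text \<open>A ghost edge runs backwards. With these endpoint maps, (E1), (E2) and the case u = v of
  (V) all say that a generator is fixed by the vertices at its two ends.\<close>

fun source :: "('v, 'e) lpa_gen \<Rightarrow> 'v" where
  "source (Vertex v) = v" | "source (Edge e) = tail G e" | "source (Ghost e) = head G e"

fun target :: "('v, 'e) lpa_gen \<Rightarrow> 'v" where
  "target (Vertex v) = v" | "target (Edge e) = head G e" | "target (Ghost e) = tail G e"

lemma relations_V_E:
  assumes "x \<in> lpa_gens G"
  shows "gen (Vertex (source x)) * gen x - gen x \<in> I" "gen x * gen (Vertex (target x)) - gen x \<in> I"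
proof -
  have "gen (Vertex (source x)) * gen x - gen x \<in> lpa_relations K G \<and>
        gen x * gen (Vertex (target x)) - gen x \<in> lpa_relations K G"
  proof (cases x)
    case (Vertex v)
    then have v: "v \<in> verts G" using assms by simp
    have "gen (Vertex v) * gen (Vertex v) - (if v = v then gen (Vertex v) else 0) \<in> lpa_relations K G"
      unfolding lpa_relations_def
      by ((rule UnI1)+, rule CollectI, rule exI[of _ v], rule exI[of _ v], simp add: v)
    then show ?thesis using Vertex by simp
  next
    case (Edge e)
    then show ?thesis
      using assms unfolding lpa_relations_def Edge source.simps target.simps lpa_gens_simps by blast
  next
    case (Ghost e)
    then show ?thesis
      using assms unfolding lpa_relations_def Ghost source.simps target.simps lpa_gens_simps by blast
  qed
  then show "gen (Vertex (source x)) * gen x - gen x \<in> I" "gen x * gen (Vertex (target x)) - gen x \<in> I"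
    by (blast intro: relations_in_I)+
qed

lemma relation_CK1:
  assumes "e \<in> arcs G" "f \<in> arcs G"
  shows "gen (Ghost e) * gen (Edge f) - (if e = f then gen (Vertex (head G e)) else 0) \<in> I"
  using assms by (intro relations_in_I) (unfold lpa_relations_def, blast)

lemma source_target_verts [simp]:
  "x \<in> lpa_gens G \<Longrightarrow> source x \<in> verts G" "x \<in> lpa_gens G \<Longrightarrow> target x \<in> verts G"
  by (cases x; simp)+

lemma relation_V_ne:
  assumes "u \<in> verts G" "v \<in> verts G" "u \<noteq> v"
  shows "gen (Vertex u) * gen (Vertex v) \<in> I"
proof (rule relations_in_I)
  have "gen (Vertex u) * gen (Vertex v) - (if u = v then gen (Vertex u) else 0) \<in> lpa_relations K G"
    unfolding lpa_relations_def
    by ((rule UnI1)+, rule CollectI, rule exI[of _ u], rule exI[of _ v], simp add: assms)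
  then show "gen (Vertex u) * gen (Vertex v) \<in> lpa_relations K G"
    using assms(3) by simp
qed

text \<open>Insert the end u of x and the start w of y: xy is congruent to x u w y, and u w lies in
  I because the two vertices differ.\<close>

lemma gen_mult_ne:
  assumes "x \<in> lpa_gens G" "y \<in> lpa_gens G" "target x \<noteq> source y"
  shows "gen x * gen y \<in> I"
proof -
  let ?x = "gen x :: _ \<Rightarrow>\<^sub>0 'k" and ?y = "gen y :: _ \<Rightarrow>\<^sub>0 'k"
  let ?u = "gen (Vertex (target x))" and ?v = "gen (Vertex (source y))"
  have "?x * ?y = ?x * (?u * ?v) * ?y - (?x * ?u - ?x) * (?v * ?y) - ?x * (?v * ?y - ?y)"
    by (simp add: algebra_simps)
  moreover have "?x \<in> carrier A" "?y \<in> carrier A" "?v \<in> carrier A"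
    using assms by (auto intro: free_algebra_closed)
  ultimately show ?thesis
    using relation_V_ne[of "target x" "source y"] relations_V_E(2)[OF assms(1)] relations_V_E(1)[OF assms(2)] assms
    by (metis I_closed(4-6) free_algebra_closed(6) source_target_verts)
qed

lemma vertex_mult_gen:
  assumes "x \<in> lpa_gens G" "v \<in> verts G"
  shows "gen (Vertex v) * gen x - (if v = source x then gen x else 0) \<in> I"
    "gen x * gen (Vertex v) - (if v = target x then gen x else 0) \<in> I"
  using assms relations_V_E[OF assms(1)] gen_mult_ne[of "Vertex v" x] gen_mult_ne[of x "Vertex v"] by auto

section \<open>The sum of the vertices as identity\<close>

lemma one_in_A0: "(\<Sum>v\<in>verts G. gen (Vertex v)) \<in> A0"
  by (rule A0_sum) (auto intro: A0_closed)

lemma I_sum: "(\<And>b. b \<in> B \<Longrightarrow> h b \<in> I) \<Longrightarrow> sum h B \<in> I"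
  by (induction B rule: infinite_finite_induct) (auto intro: I_closed)

lemma one_mult_gen:
  assumes "x \<in> lpa_gens G" "finite (verts G)"
  shows "(\<Sum>v\<in>verts G. gen (Vertex v)) * gen x - gen x \<in> I" "gen x * (\<Sum>v\<in>verts G. gen (Vertex v)) - gen x \<in> I"
proof -
  \<comment> \<open>The generator x is itself written as a sum over all vertices with one nonzero
    term, so that each term of the difference lies in I.\<close>
  have "(\<Sum>v\<in>verts G. gen (Vertex v)) * gen x - gen x =
      (\<Sum>v\<in>verts G. gen (Vertex v) * gen x - (if v = source x then gen x else 0 :: _ \<Rightarrow>\<^sub>0 'k))"
    "gen x * (\<Sum>v\<in>verts G. gen (Vertex v)) - gen x =
      (\<Sum>v\<in>verts G. gen x * gen (Vertex v) - (if v = target x then gen x else 0 :: _ \<Rightarrow>\<^sub>0 'k))"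
    using assms by (simp_all add: sum_subtractf sum_distrib_left sum_distrib_right)
  then show "(\<Sum>v\<in>verts G. gen (Vertex v)) * gen x - gen x \<in> I" "gen x * (\<Sum>v\<in>verts G. gen (Vertex v)) - gen x \<in> I"
    using vertex_mult_gen[OF assms(1)] by (auto intro!: I_sum)
qed

lemma one_mult:
  assumes fin: "finite (verts G)" and p: "p \<in> A0"
  shows "(\<Sum>v\<in>verts G. gen (Vertex v)) * p - p \<in> I \<and> p * (\<Sum>v\<in>verts G. gen (Vertex v)) - p \<in> I"
proof -
  let ?u = "\<Sum>v\<in>verts G. gen (Vertex v) :: _ \<Rightarrow>\<^sub>0 'k"
  \<comment> \<open>Without a constant term every word has a first and a last letter, and these
    absorb the identity from the left and from the right.\<close>
  have "Poly_Mapping.keys p \<subseteq> words - {0}"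
    using p by (auto simp: A0_def carrier_free_algebra in_keys_iff)
  then show ?thesis
  proof (induction p rule: poly_mapping_induct_single)
    case zero
    then show ?case by (simp add: I_closed)
  next
    case (add p q)
    have "?u * (p + q) - (p + q) = (?u * p - p) + (?u * q - q)"
      "(p + q) * ?u - (p + q) = (p * ?u - p) + (q * ?u - q)" by (simp_all add: algebra_simps)
    then show ?case using add by (metis I_closed(2))
  next
    case (single w a)
    obtain l where w: "w = Word l" by (cases w)
    with single have l: "l \<noteq> []" "set l \<subseteq> lpa_gens G" by (auto simp: zero_free_monoid_def)
    obtain x xs where x: "l = x # xs" using l(1) by (cases l) auto
    obtain ys y where y: "l = ys @ [y]" using l(1) by (cases l rule: rev_cases) auto
    let ?s = "Poly_Mapping.single (Word xs) a" and ?t = "Poly_Mapping.single (Word ys) a"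
    have "?u * Poly_Mapping.single w a - Poly_Mapping.single w a = (?u * gen x - gen x) * ?s"
      unfolding w x single_Word_Cons by (simp add: algebra_simps)
    moreover have "Poly_Mapping.single w a * ?u - Poly_Mapping.single w a = ?t * (gen y * ?u - gen y)"
      unfolding w y single_Word_snoc by (simp add: algebra_simps)
    moreover have "?s \<in> carrier A" "x \<in> lpa_gens G"
      using l(2) by (auto simp: x intro!: free_algebra_closed)
    moreover have "?t \<in> carrier A" "y \<in> lpa_gens G"
      using l(2) by (auto simp: y intro!: free_algebra_closed)
    ultimately show ?case
      using one_mult_gen fin by (auto intro: I_closed)
  qed
qed

end

section \<open>The grading\<close>

fun letter_degree :: "('v, 'e) lpa_gen \<Rightarrow> int" where
  "letter_degree (Vertex v) = 0" | "letter_degree (Edge e) = 1" | "letter_degree (Ghost e) = - 1"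

definition word_degree :: "('v, 'e) lpa_gen free_monoid \<Rightarrow> int"
  where "word_degree w = sum_list (map letter_degree (letters w))"

definition component :: "int \<Rightarrow> (('v, 'e) lpa_gen free_monoid \<Rightarrow>\<^sub>0 'k::field) \<Rightarrow> (('v, 'e) lpa_gen free_monoid \<Rightarrow>\<^sub>0 'k)"
  where "component d = linear_extension (\<lambda>w. if word_degree w = d then Poly_Mapping.single w 1 else 0)"

lemma word_degree_plus: "word_degree (u + w) = word_degree u + word_degree w"
  by (simp add: word_degree_def plus_free_monoid_def)

lemma component_zero [simp]: "component d 0 = 0"
  and component_add: "component d (p + q) = component d p + component d q"
  and component_minus: "component d (p - q) = component d p - component d q"
  and component_sum: "component d (sum h B) = (\<Sum>b\<in>B. component d (h b))"
  by (simp_all add: component_def linear_extension_add linear_extension_minus linear_extension_sum)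

lemma component_single:
  "component d (Poly_Mapping.single w a) = (if word_degree w = d then Poly_Mapping.single w a else 0)"
  by (simp add: component_def)

lemma component_single_mult:
  "component d (Poly_Mapping.single u a * p) = Poly_Mapping.single u a * component (d - word_degree u) p"
proof -
  have "Poly_Mapping.keys p \<subseteq> UNIV" by simp
  then show ?thesis
    by (induction p rule: poly_mapping_induct_single)
       (auto simp: component_add distrib_left mult_single component_single word_degree_plus)
qed

lemma component_mult_single:
  "component d (p * Poly_Mapping.single u a) = component (d - word_degree u) p * Poly_Mapping.single u a"
proof -
  have "Poly_Mapping.keys p \<subseteq> UNIV" by simp
  then show ?thesis
    by (induction p rule: poly_mapping_induct_single)
       (auto simp: component_add distrib_right mult_single component_single word_degree_plus)
qed

lemma component_gen:
  "component d (gen x) = (if letter_degree x = d then gen x else 0)"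
  "component d (gen x * gen y) = (if letter_degree x + letter_degree y = d then gen x * gen y else 0)"
  unfolding gen_mult_gen by (simp_all add: gen_def component_single word_degree_def)

lemma lookup_component:
  "Poly_Mapping.lookup (component d p) w = (if word_degree w = d then Poly_Mapping.lookup p w else 0)"
proof -
  have "Poly_Mapping.keys p \<subseteq> UNIV" by simp
  then show ?thesis
    by (induction p rule: poly_mapping_induct_single)
       (auto simp: component_add lookup_add component_single lookup_single when_def)
qed

lemma component_sum_eq: "p = (\<Sum>d\<in>word_degree ` Poly_Mapping.keys p. component d p)"
  by (rule poly_mapping_eqI) (auto simp: lookup_sum lookup_component sum.delta in_keys_iff)

context leavitt
begin

text \<open>Every relation is homogeneous: (E1) has degree 1, (E2) degree -1, and (V), (CK1), (CK2)
  have degree 0.\<close>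

lemma component_relation:
  assumes "r \<in> lpa_relations K G"
  shows "component d r \<in> {r, 0}"
  using assms unfolding lpa_relations_def
  by (elim UnE CollectE exE conjE) (simp_all add: component_minus component_gen component_sum)

text \<open>An ideal generated by homogeneous elements is graded. The degree is generalised in the
  induction because a word factor shifts it.\<close>

lemma component_I: "p \<in> I \<Longrightarrow> component d p \<in> I"
proof (induction p arbitrary: d rule: I_induct)
  case (relation r)
  then show ?case
    using component_relation[OF relation, of d] relations_in_I[OF relation] I_closed(1) by auto
next
  case (left w a p)
  then show ?case
    unfolding component_single_mult by (intro I_closed(5)) (auto intro: free_algebra_closed)
next
  case (right w a p)
  then show ?case
    unfolding component_mult_single by (intro I_closed(6)) (auto intro: free_algebra_closed)
qed (auto simp: component_add intro: I_closed(1,2))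

text \<open>Right multiplication by a word of positive degree shifts the grading, so it fixes no nonzero class.\<close>

lemma no_fixed_point_modulo_I:
  assumes p: "p \<in> carrier A" and w: "w \<in> words" "0 < word_degree w"
    and fixed: "p * Poly_Mapping.single w 1 - p \<in> I"
  shows "p \<in> I"
proof -
  have step: "component d p \<in> I" if "component (d - word_degree w) p \<in> I" for d
  proof -
    have "component (d - word_degree w) p * Poly_Mapping.single w 1 - component d p \<in> I"
      using component_I[OF fixed, of d] by (simp add: component_minus component_mult_single)
    moreover have "component (d - word_degree w) p * Poly_Mapping.single w 1 \<in> I"
      using that w by (auto intro!: I_closed free_algebra_closed)
    ultimately show ?thesis using I_closed(4) by fastforce
  qed
  let ?D = "word_degree ` Poly_Mapping.keys p"
  have "component d p \<in> I" for d
  proof (rule ccontr)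
    assume *: "component d p \<notin> I"
    have "component (d - int n * word_degree w) p \<notin> I" for n
    proof (induction n)
      case (Suc n)
      then show ?case using step[of "d - int n * word_degree w"] by (auto simp: algebra_simps)
    qed (use * in simp)
    moreover have "component d p = 0" if "d \<notin> ?D" for d
      using that by (intro poly_mapping_eqI) (auto simp: lookup_component in_keys_iff image_iff)
    ultimately have "d - int n * word_degree w \<in> ?D" for n
      using I_closed(1) by metis
    then have "range (\<lambda>n. d - int n * word_degree w) \<subseteq> ?D" by blast
    moreover have "inj (\<lambda>n. d - int n * word_degree w)"
      using w(2) by (auto intro!: injI)
    then have "infinite (range (\<lambda>n. d - int n * word_degree w))"
      by (rule range_inj_infinite)
    ultimately show False
      by (meson finite_imageI finite_keys finite_subset)
  qed
  then show ?thesis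
    by (subst component_sum_eq) (auto intro: I_sum)
qed

end

section \<open>The Chen module\<close>

lemma infinite_path_SCons:
  "infinite_path G (e ## q) \<longleftrightarrow> e \<in> arcs G \<and> head G e = tail G (shd q) \<and> infinite_path G q"
proof
  assume *: "infinite_path G (e ## q)"
  have "q !! i \<in> arcs G \<and> head G (q !! i) = tail G (q !! Suc i)" for i
    using *[unfolded infinite_path_def, rule_format, of "Suc i"] by simp
  then show "e \<in> arcs G \<and> head G e = tail G (shd q) \<and> infinite_path G q"
    using *[unfolded infinite_path_def, rule_format, of 0] by (simp add: infinite_path_def)
next
  assume *: "e \<in> arcs G \<and> head G e = tail G (shd q) \<and> infinite_path G q"
  have "(e ## q) !! i \<in> arcs G \<and> head G ((e ## q) !! i) = tail G ((e ## q) !! Suc i)" for i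
    using * by (cases i) (auto simp: infinite_path_def)
  then show "infinite_path G (e ## q)" by (simp add: infinite_path_def)
qed

locale chen = leavitt G K for G :: "('v, 'e) pre_digraph" and K :: "'k::field itself" +
  fixes p\<^sub>0 :: "'e stream"
begin

abbreviation "T \<equiv> tail_class G p\<^sub>0"
abbreviation "V \<equiv> chen_module K G p\<^sub>0"

lemma T_SCons:
  "e ## q \<in> T \<longleftrightarrow> e \<in> arcs G \<and> head G e = tail G (shd q) \<and> q \<in> T"
proof -
  have "tail_equivalent p\<^sub>0 (e ## q) \<longleftrightarrow> tail_equivalent p\<^sub>0 q"
  proof
    assume "tail_equivalent p\<^sub>0 (e ## q)"
    then obtain m n where "sdrop m p\<^sub>0 = sdrop n (e ## q)" by (auto simp: tail_equivalent_def)
    \<comment> \<open>Dropping one more edge on both sides removes e even when n = 0.\<close>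
    then have "sdrop 1 (sdrop m p\<^sub>0) = sdrop 1 (sdrop n (e ## q))" by simp
    then have "sdrop (Suc m) p\<^sub>0 = sdrop n q"
      by (simp only: sdrop_add) simp
    then show "tail_equivalent p\<^sub>0 q" unfolding tail_equivalent_def by blast
  next
    assume "tail_equivalent p\<^sub>0 q"
    then obtain m n where "sdrop m p\<^sub>0 = sdrop n q" by (auto simp: tail_equivalent_def)
    then have "sdrop m p\<^sub>0 = sdrop (Suc n) (e ## q)" by simp
    then show "tail_equivalent p\<^sub>0 (e ## q)" unfolding tail_equivalent_def by blast
  qed
  then show ?thesis by (auto simp: tail_class_def infinite_path_SCons)
qed

lemma T_cases:
  assumes "q \<in> T"
  obtains f r where "q = f ## r" "f \<in> arcs G" "head G f = tail G (shd r)" "r \<in> T"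
  using assms by (cases q) (auto simp: T_SCons)

lemma carrier_V: "m \<in> carrier V \<longleftrightarrow> Poly_Mapping.keys m \<subseteq> T"
  by (simp add: chen_module_def)

lemma keys_gen_action:
  assumes "x \<in> lpa_gens G" "q \<in> T"
  shows "Poly_Mapping.keys (gen_action G x q) \<subseteq> T"
  using assms by (cases x) (auto simp: T_SCons elim: T_cases)

lemma V_closed:
  "0 \<in> carrier V" "m \<in> carrier V \<Longrightarrow> n \<in> carrier V \<Longrightarrow> m + n \<in> carrier V"
  "m \<in> carrier V \<Longrightarrow> scale a m \<in> carrier V" "q \<in> T \<Longrightarrow> Poly_Mapping.single q a \<in> carrier V"
  using keys_add[of m n] by (auto simp: carrier_V in_keys_iff lookup_scale subset_iff lookup_single when_def)

lemma action_closed: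
  assumes "p \<in> carrier A" "m \<in> carrier V"
  shows "free_algebra_action G p m \<in> carrier V"
proof -
  have 1: "word_action G (Word xs) m \<in> carrier V" if "set xs \<subseteq> lpa_gens G" for xs
    using that
  proof (induction xs)
    case (Cons x xs)
    have "word_action G (Word (x # xs)) m = linear_extension (gen_action G x) (word_action G (Word xs) m)"
      by (simp add: word_action_def)
    moreover have "Poly_Mapping.keys (linear_extension (gen_action G x) (word_action G (Word xs) m)) \<subseteq> T"
      using Cons by (intro keys_linear_extension[where S = T] keys_gen_action) (auto simp: carrier_V)
    ultimately show ?case by (simp add: carrier_V)
  qed (use assms in \<open>simp add: word_action_def\<close>)
  have "word_action G w m \<in> carrier V" if "w \<in> words" for w
    using 1[of "letters w"] that by simp
  moreover have "Poly_Mapping.keys p \<subseteq> words" using assms by (simp add: carrier_free_algebra)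
  ultimately show ?thesis
    unfolding free_algebra_action_def carrier_V
    by (intro keys_linear_extension[where S = words]) auto
qed

text \<open>Splitting off the first edge f of q decides every case distinction in
  \<open>gen_action\<close>.\<close>

lemma relation_annihilates:
  assumes r: "r \<in> lpa_relations K G" and q: "q \<in> T"
  shows "free_algebra_action G r (Poly_Mapping.single q 1) = 0"
proof -
  obtain f s where fs: "q = f ## s" "f \<in> arcs G" "head G f = tail G (shd s)" "s \<in> T"
    using q by (rule T_cases)
  \<comment> \<open>Only the ghost of the first edge f acts nontrivially on q, and f puts back what
    it removed.\<close>
  have CK2: "(\<Sum>e\<in>out_arcs G v. free_algebra_action G (gen (Edge e)) (free_algebra_action G (gen (Ghost e)) (Poly_Mapping.single q 1)))
      = (if v = tail G f then Poly_Mapping.single q (1::'k) else 0)" if "finite (out_arcs G v)" for v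
  proof -
    have "(\<Sum>e\<in>out_arcs G v. free_algebra_action G (gen (Edge e)) (free_algebra_action G (gen (Ghost e)) (Poly_Mapping.single q 1)))
      = (\<Sum>e\<in>out_arcs G v. if e = f then Poly_Mapping.single q (1::'k) else 0)"
      by (rule sum.cong) (auto simp: action_gen fs)
    then show ?thesis using that fs by (auto simp: sum.delta')
  qed
  show ?thesis
    using r unfolding lpa_relations_def
    by (elim UnE CollectE exE conjE)
       (use fs CK2 in \<open>auto simp: action_minus_left action_mult action_gen action_zero_left action_sum_left\<close>)
qed

text \<open>The vector m is generalised because a right factor acts on it first. It must stay in V,
  since the relations were only shown to vanish on paths of the tail class.\<close>

lemma I_annihilates: "p \<in> I \<Longrightarrow> m \<in> carrier V \<Longrightarrow> free_algebra_action G p m = 0"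
proof (induction p arbitrary: m rule: I_induct)
  case (relation r)
  then have "Poly_Mapping.keys m \<subseteq> T" by (simp add: carrier_V)
  then show ?case
  proof (induction m rule: poly_mapping_induct_single)
    case (single q a)
    have "free_algebra_action G r (scale a (Poly_Mapping.single q 1)) = 0"
      using relation_annihilates[OF relation(1) single] by (simp only: action_linear_right scale_simps(2))
    then show ?case by simp
  qed (simp_all add: action_linear_right)
next
  case (right w a p)
  then show ?case by (simp add: action_mult action_closed free_algebra_closed(7))
qed (auto simp: action_zero_left action_add_left action_mult action_linear_right)

text \<open>The representative picked by \<open>SOME\<close> differs from p by an element of I,
  which acts as zero.\<close>

lemma smult_V:
  assumes "p \<in> carrier A" "m \<in> carrier V"
  shows "lpa_class G p \<odot>\<^bsub>V\<^esub> m = free_algebra_action G p m"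
proof -
  have "0 + p \<in> lpa_class G p" unfolding class_image using I_closed(1) by blast
  then have "(SOME a. a \<in> lpa_class G p) \<in> lpa_class G p" by (rule someI)
  then obtain i where "i \<in> I" "(SOME a. a \<in> lpa_class G p) = i + p"
    unfolding class_image by blast
  then show ?thesis
    using assms by (simp add: chen_module_def action_add_left I_annihilates)
qed

lemma V_simps: "zero V = 0" "add V = (+)"
  by (simp_all add: chen_module_def)

sublocale V: left_module L V
proof (intro left_module.intro left_module_axioms.intro L.nonunital_ring_axioms)
  show "abelian_group V"
  proof (rule abelian_groupI, goal_cases)
    case (6 m)
    have "scale (- 1) m + m = scale (- 1 + 1) m" by (simp only: scale_add_left scale_simps)
    then show ?case
      using 6 by (intro bexI[of _ "scale (- 1) m"]) (auto simp: V_simps V_closed)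
  qed (auto simp: V_simps V_closed add_ac)
qed (auto simp: carrier_L V_simps add_L mult_L smult_V A0_closed A0_subset action_closed V_closed
      action_add_left action_linear_right action_mult free_algebra_closed)

end

section \<open>Paths ending in a simple closed path\<close>

text \<open>Both cd and dc are initial segments of c^\<infinity>, and they have equal length. Hence
  c and d commute, and commuting words are powers of a common word.\<close>

lemma cycle_shift_root:
  assumes c: "c \<noteq> []" and d: "cycle c = d @- cycle c"
  obtains n m b where "c = concat (replicate m b)" "d = concat (replicate n b)"
proof -
  have cc: "cycle c = c @- cycle c" by (rule cycle_decomp[OF c])
  have "(c @ d) @- cycle c = (d @ c) @- cycle c"
    using cc d by (metis shift_append)
  then have "stake (length (c @ d)) ((c @ d) @- cycle c) = stake (length (d @ c)) ((d @ c) @- cycle c)"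
    by (simp add: add.commute)
  then have "c @ d = d @ c" by (simp only: stake_shift) simp
  then show ?thesis using comm_append_are_replicate[of c d] that by metis
qed

lemma shift_eq_shift:
  "xs @- s = ys @- t \<Longrightarrow> length xs \<le> length ys \<Longrightarrow> \<exists>zs. ys = xs @ zs \<and> s = zs @- t"
proof (induction xs arbitrary: ys)
  case (Cons x xs)
  then show ?case by (cases ys) auto
qed auto

text \<open>As m is at least 2, a second copy of b follows the first one, so b ends at the vertex
  where it starts.\<close>

lemma closed_walk_root:
  assumes G: "wf_digraph G" and c: "wf_digraph.closed_w G c" "c = concat (replicate m b)" "2 \<le> m"
  shows "wf_digraph.closed_w G b"
proof -
  interpret wf_digraph G by (rule G)
  obtain u where u: "awalk u c u" "c \<noteq> []" using c(1) by (auto simp: closed_w_def)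
  obtain k where "m = Suc (Suc k)" using c(3) by (metis add_2_eq_Suc le_Suc_ex)
  then have b: "c = b @ b @ concat (replicate k b)" using c(2) by simp
  then obtain e es where e: "b = e # es" using u(2) c(2) by (cases b) auto
  have "awalk u b (awlast u b)" "awalk (awlast u b) (b @ concat (replicate k b)) u"
    using u(1) unfolding b awalk_append_iff by blast+
  moreover from this have "u = tail G e" "awlast u b = tail G e"
    unfolding e by (simp_all add: awalk_Cons_iff)
  ultimately show ?thesis using e by (auto simp: closed_w_def)
qed

lemma infinite_path_cycle:
  assumes G: "wf_digraph G" and c: "wf_digraph.closed_w G c"
  shows "infinite_path G (Stream.cycle c)"
proof -
  interpret wf_digraph G by (rule G)
  obtain u where u: "awalk u c u" "c \<noteq> []" using c by (auto simp: closed_w_def)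
  \<comment> \<open>The walk p ends where s starts, so the last index of p is included: there the
    successor is the first edge of s.\<close>
  have walk: "(p @- s) !! i \<in> arcs G \<and> head G ((p @- s) !! i) = tail G ((p @- s) !! Suc i)"
    if "awalk x p (tail G (shd s))" "i < length p" for x p s i
    using that
  proof (induction p arbitrary: x i)
    case (Cons e p)
    show ?case
    proof (cases i)
      case 0
      then show ?thesis using Cons.prems by (cases p) (auto simp: awalk_simps)
    next
      case (Suc j)
      then show ?thesis using Cons.IH[of "head G e" j] Cons.prems by (simp add: awalk_Cons_iff)
    qed
  qed simp
  have "u = tail G (shd (Stream.cycle c))"
    using u by (cases c) (auto simp: awalk_simps)
  then have w: "awalk u c (tail G (shd (Stream.cycle c)))" using u(1) by simp
  have "Stream.cycle c !! i \<in> arcs G \<and> head G (Stream.cycle c !! i) = tail G (Stream.cycle c !! Suc i)" for i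
  proof (induction i rule: less_induct)
    case (less i)
    show ?case
    proof (cases "i < length c")
      case True
      then show ?thesis using walk[OF w True] by (simp only: cycle_decomp[OF u(2), symmetric])
    next
      case False
      \<comment> \<open>Periodicity moves any position beyond the first copy of c back by the length
        of c.\<close>
      have "Stream.cycle c !! k = Stream.cycle c !! (k - length c)" if "length c \<le> k" for k
      proof -
        have "Stream.cycle c !! k = (c @- Stream.cycle c) !! k"
          by (simp only: cycle_decomp[OF u(2), symmetric])
        then show ?thesis using that by (simp only: shift_snth_ge)
      qed
      then have "Stream.cycle c !! i = Stream.cycle c !! (i - length c)"
        "Stream.cycle c !! Suc i = Stream.cycle c !! Suc (i - length c)"
        using False by (metis Suc_diff_le le_SucI not_less)+
      moreover have "i - length c < i" using False u(2) by (cases c) auto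
      ultimately show ?thesis using less by (simp only:)
    qed
  qed
  then show ?thesis by (simp add: infinite_path_def)
qed

text \<open>Stored as one monomial so that the degree shift of \<open>component_mult_single\<close>
  applies directly; \<open>prod_list_edges\<close> identifies it with the product in
  \<open>lpa_path\<close>.\<close>

definition edge_word :: "'e list \<Rightarrow> (('v, 'e) lpa_gen free_monoid \<Rightarrow>\<^sub>0 'k::field)"
  where "edge_word es = Poly_Mapping.single (Word (map Edge es)) 1"

lemma edge_word_simps [simp]:
  "(edge_word [] :: ('v, 'e) lpa_gen free_monoid \<Rightarrow>\<^sub>0 'k::field) = 1" "edge_word (e # es) = gen (Edge e) * edge_word es"
  "edge_word (es @ fs) = edge_word es * edge_word fs"
proof -
  have "(Word [] :: ('v, 'e) lpa_gen free_monoid) = 0" by (simp add: zero_free_monoid_def)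
  then show "(edge_word [] :: ('v, 'e) lpa_gen free_monoid \<Rightarrow>\<^sub>0 'k) = 1" by (simp add: edge_word_def)
qed (simp_all add: edge_word_def gen_def mult_single plus_free_monoid_def)

lemma prod_list_edges: "prod_list (map (\<lambda>e. gen (Edge e)) es) = edge_word es"
  by (induction es) simp_all

section \<open>Paths ending at the base of the cycle\<close>

locale chen_cycle = chen G K "cycle c"
  for G :: "('v, 'e) pre_digraph" and K :: "'k::field itself" and c :: "'e list" +
  assumes simple: "simple_closed_path G c"
begin

abbreviation "base \<equiv> tail G (hd c)"
abbreviation "v \<equiv> (gen (Vertex base) :: ('v, 'e) lpa_gen free_monoid \<Rightarrow>\<^sub>0 'k)"
abbreviation "cw \<equiv> (edge_word c :: ('v, 'e) lpa_gen free_monoid \<Rightarrow>\<^sub>0 'k)"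
abbreviation "c_inf \<equiv> (Poly_Mapping.single (cycle c) 1 :: 'e stream \<Rightarrow>\<^sub>0 'k)"

lemma closed_c: "wf_digraph.closed_w G c"
  using simple by (simp add: simple_closed_path_def)

lemma c_ne [simp]: "c \<noteq> []"
  using closed_c wf by (auto simp: wf_digraph.closed_w_def)

lemma c_shift_cycle [simp]: "c @- cycle c = cycle c"
  using cycle_decomp[OF c_ne] by simp

lemma cycle_T [simp]: "cycle c \<in> T"
  using infinite_path_cycle[OF wf closed_c] by (auto simp: tail_class_def tail_equivalent_def)

lemma c_inf_V: "c_inf \<in> carrier V"
  by (simp add: V_closed)

lemma shift_T:
  assumes "es @- q \<in> T"
  shows "q \<in> T" "set es \<subseteq> arcs G"
  using assms by (induction es) (auto simp: T_SCons)

lemma edge_word_closed: "set es \<subseteq> arcs G \<Longrightarrow> edge_word es \<in> carrier A"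
  by (induction es) (simp_all add: free_algebra_closed)

lemma arcs_c: "set c \<subseteq> arcs G"
  using shift_T(2)[of c "cycle c"] by simp

lemma hd_c_arc [simp]: "hd c \<in> arcs G"
  using arcs_c hd_in_set[OF c_ne] by blast

lemma cw_A: "cw \<in> carrier A"
  using arcs_c by (rule edge_word_closed)

lemma v_A0: "v \<in> A0"
  by (intro A0_closed) simp

lemma v_A: "v \<in> carrier A"
  using v_A0 by (rule A0_subset)

lemma edge_word_A0: "es \<noteq> [] \<Longrightarrow> set es \<subseteq> arcs G \<Longrightarrow> edge_word es \<in> A0"
  by (cases es) (auto intro!: A0_closed(6,7) edge_word_closed)

lemma cw_A0: "cw \<in> A0"
  using arcs_c by (intro edge_word_A0) simp_all

text \<open>The factor v makes the formula uniform: the path of length 0 at the base is v, whereas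
  \<open>edge_word []\<close> is 1.\<close>

lemma source_path:
  assumes "es @- cycle c \<in> T"
  shows "gen (Vertex (tail G (shd (es @- cycle c)))) * (edge_word es * v) - edge_word es * v \<in> I"
proof (cases es)
  case Nil
  then show ?thesis using relations_V_E(1)[of "Vertex base"] by simp
next
  case (Cons e ds)
  then have "e \<in> arcs G" "set ds \<subseteq> arcs G" using shift_T(2)[OF assms] by auto
  then have "(gen (Vertex (tail G e)) * gen (Edge e) - gen (Edge e)) * (edge_word ds * v) \<in> I"
    using relations_V_E(1)[of "Edge e"] by (intro I_closed(6) free_algebra_closed edge_word_closed v_A) auto
  then show ?thesis by (simp add: Cons algebra_simps)
qed

text \<open>The last edge of es is followed by c^\<infinity> and therefore ends at the base; being
  nonempty matters, as the empty product 1 does not absorb v.\<close>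

lemma path_target:
  assumes "es @- cycle c \<in> T" "es \<noteq> []"
  shows "edge_word es * v - edge_word es \<in> I"
  using assms
proof (induction es)
  case (Cons e es)
  then have e: "e \<in> arcs G" "head G e = tail G (shd (es @- cycle c))" "es @- cycle c \<in> T"
    by (simp_all add: T_SCons)
  show ?case
  proof (cases "es = []")
    case True
    then show ?thesis using e relations_V_E(2)[of "Edge e"] by simp
  next
    case False
    then have "gen (Edge e) * (edge_word es * v - edge_word es) \<in> I"
      using False e Cons.IH by (intro I_closed(5) free_algebra_closed) auto
    then show ?thesis by (simp add: algebra_simps)
  qed
qed simp

lemma cw_v: "cw * v - cw \<in> I"
  by (intro path_target) simp_all

lemma v_cw: "v * cw - cw \<in> I"
proof -
  have "v * (cw * v) - cw * v \<in> I"
    using source_path[of c] by simp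
  moreover have "v * (cw * v - cw) \<in> I" using cw_v v_A by (intro I_closed(5))
  moreover have "v * cw - cw = (v * (cw * v) - cw * v) - v * (cw * v - cw) + (cw * v - cw)"
    by (simp add: algebra_simps)
  ultimately show ?thesis using cw_v by (metis I_closed(2,4))
qed

lemma v_v: "v * v - v \<in> I"
  using relations_V_E(1)[of "Vertex base"] by simp

text \<open>The preimage in A of the left ideal generated by c - v in A/I. Taking s from A rather
  than from \<open>A0\<close> makes it a left ideal of A containing c - v, through s = 1; elements
  of \<open>A0\<close> are recovered at the end from sv.\<close>

definition J :: "(('v, 'e) lpa_gen free_monoid \<Rightarrow>\<^sub>0 'k) set"
  where "J = {x \<in> carrier A. \<exists>s\<in>carrier A. x - s * (cw - v) \<in> I}"

lemma I_subset_J: "x \<in> I \<Longrightarrow> x \<in> J"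
  unfolding J_def using I_subset free_algebra_closed(1) by (auto intro!: bexI[of _ 0])

lemma J_add: assumes "x \<in> J" "y \<in> J" shows "x + y \<in> J"
proof -
  obtain s t where s: "s \<in> carrier A" "x - s * (cw - v) \<in> I" and t: "t \<in> carrier A" "y - t * (cw - v) \<in> I"
    using assms by (auto simp: J_def)
  have "(x + y) - (s + t) * (cw - v) = (x - s * (cw - v)) + (y - t * (cw - v))"
    by (simp add: algebra_simps)
  then have "(x + y) - (s + t) * (cw - v) \<in> I" using s t by (metis I_closed(2))
  then show ?thesis
    using assms s t unfolding J_def by (auto intro!: free_algebra_closed bexI[of _ "s + t"])
qed

lemma J_mult: assumes "x \<in> J" "a \<in> carrier A" shows "a * x \<in> J"
proof -
  obtain s where s: "s \<in> carrier A" "x - s * (cw - v) \<in> I"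
    using assms by (auto simp: J_def)
  have "a * x - (a * s) * (cw - v) = a * (x - s * (cw - v))"
    by (simp add: algebra_simps)
  then have "a * x - (a * s) * (cw - v) \<in> I" using s assms by (metis I_closed(5))
  then show ?thesis
    using assms s unfolding J_def by (auto intro!: free_algebra_closed(6) bexI[of _ "a * s"])
qed

lemma J_scale: "x \<in> J \<Longrightarrow> scale a x \<in> J"
  unfolding scale_eq_mult by (rule J_mult) (auto intro!: free_algebra_closed simp: zero_free_monoid_def)

lemma J_minus: assumes "x \<in> J" "y \<in> J" shows "x - y \<in> J"
  using J_add[OF assms(1) J_mult[OF assms(2), of "- 1"]] by (simp add: free_algebra_closed)

lemma J_zero: "0 \<in> J"
  by (intro I_subset_J I_closed)

lemma J_trans: "x - y \<in> J \<Longrightarrow> y - z \<in> J \<Longrightarrow> x - z \<in> J"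
  using J_add[of "x - y" "y - z"] by simp

lemma J_sym: "x - y \<in> J \<Longrightarrow> y - x \<in> J"
  using J_minus[OF J_zero, of "x - y"] by simp

lemma cw_minus_v_J: "cw - v \<in> J"
  unfolding J_def using I_closed(1) cw_A v_A
  by (auto intro!: free_algebra_closed bexI[of _ 1])

text \<open>Telescoping: c^(n+1) v - v = c (c^n v - v) + (cv - c) + (c - v), where the left factor c
  is harmless.\<close>

lemma cw_power_J: "edge_word (concat (replicate n c)) * v - v \<in> J"
proof (induction n)
  case (Suc n)
  let ?x = "edge_word (concat (replicate n c)) * v"
  have "edge_word (concat (replicate (Suc n) c)) * v - v = cw * (?x - v) + ((cw * v - cw) + (cw - v))"
    by (simp add: algebra_simps)
  moreover have "cw * (?x - v) + ((cw * v - cw) + (cw - v)) \<in> J"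
    by (intro J_add J_mult[OF Suc] cw_A cw_minus_v_J I_subset_J[OF cw_v])
  ultimately show ?case by (simp only:)
qed (simp add: J_zero)

text \<open>This is where simplicity of \<open>c\<close> enters.\<close>

lemma cycle_shift_power:
  assumes "cycle c = d @- cycle c"
  obtains n where "d = concat (replicate n c)"
proof -
  obtain n m b where b: "c = concat (replicate m b)" "d = concat (replicate n b)"
    using cycle_shift_root[OF c_ne assms] .
  have "m \<noteq> 0" using b(1) c_ne by (intro notI) simp
  moreover have "\<not> 2 \<le> m"
    using simple closed_walk_root[OF wf closed_c b(1)] b(1) unfolding simple_closed_path_def by blast
  ultimately have "m = 1" by linarith
  then have "c = b" using b(1) by simp
  then show ?thesis using b(2) that by blast
qed

text \<open>If the longer path is \<gamma> c^n and the shorter one \<gamma>, the difference is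
  \<gamma> (c^n v - v), a left multiple of an element of J.\<close>

lemma edge_word_determined:
  assumes T: "es @- cycle c \<in> T" and eq: "es @- cycle c = fs @- cycle c"
  shows "edge_word es * v - edge_word fs * v \<in> J"
proof -
  have *: "edge_word ys * v - edge_word xs * v \<in> J"
    if T: "xs @- cycle c \<in> T" and eq: "xs @- cycle c = ys @- cycle c" and le: "length xs \<le> length ys" for xs ys
  proof -
    obtain zs where zs: "ys = xs @ zs" "cycle c = zs @- cycle c"
      using shift_eq_shift[OF eq le] by blast
    obtain n where "zs = concat (replicate n c)" using cycle_shift_power[OF zs(2)] .
    then have "edge_word ys * v - edge_word xs * v = edge_word xs * (edge_word (concat (replicate n c)) * v - v)"
      by (simp add: zs(1) algebra_simps)
    then show ?thesis
      using J_mult[OF cw_power_J edge_word_closed[OF shift_T(2)[OF T]], of n] by (simp only:)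
  qed
  show ?thesis
  proof (cases "length es \<le> length fs")
    case True
    then show ?thesis by (rule J_sym[OF *[OF T eq]])
  next
    case False
    have "fs @- cycle c \<in> T" using T unfolding eq .
    from *[OF this eq[symmetric]] False show ?thesis by linarith
  qed
qed

section \<open>A section of the action on the periodic path\<close>

definition prefix_path :: "'e stream \<Rightarrow> 'e list"
  where "prefix_path q = (SOME es. q = es @- cycle c)"

lemma T_prefix: assumes "q \<in> T" shows "\<exists>es. q = es @- cycle c"
proof -
  obtain m n where mn: "sdrop m (cycle c) = sdrop n q"
    using assms by (auto simp: tail_class_def tail_equivalent_def)
  \<comment> \<open>Chosen so that m + k = m |c| is a multiple of the period; dropping that many
    edges from c^\<infinity> gives c^\<infinity> again.\<close>
  let ?k = "m * length c - m"
  have "m \<le> m * length c" using c_ne by (cases c) auto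
  then have "sdrop (n + ?k) q = sdrop (m * length c) (cycle c)"
    using mn by (metis sdrop_add le_add_diff_inverse)
  also have "\<dots> = cycle c" by simp
  finally have "q = stake (n + ?k) q @- cycle c" by (metis stake_sdrop)
  then show ?thesis by blast
qed

lemma prefix_path: "q \<in> T \<Longrightarrow> prefix_path q @- cycle c = q"
  unfolding prefix_path_def using someI_ex[OF T_prefix] by metis

text \<open>Modulo \<open>J\<close>, this is an \<open>A\<close>-linear section of the action on \<open>c_inf\<close>.\<close>

definition section_map :: "('e stream \<Rightarrow>\<^sub>0 'k) \<Rightarrow> (('v, 'e) lpa_gen free_monoid \<Rightarrow>\<^sub>0 'k)"
  where "section_map = linear_extension (\<lambda>q. edge_word (prefix_path q) * v)"

lemma section_map_add: "section_map (m + n) = section_map m + section_map n"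
  and section_map_scale: "section_map (scale a m) = scale a (section_map m)"
  and section_map_zero: "section_map 0 = 0"
  and section_map_single: "section_map (Poly_Mapping.single q a) = scale a (edge_word (prefix_path q) * v)"
  by (simp_all add: section_map_def linear_extension_add linear_extension_scale)

lemma section_map_A0: "m \<in> carrier V \<Longrightarrow> section_map m \<in> A0"
  unfolding carrier_V
proof (induction m rule: poly_mapping_induct_single)
  case (single q a)
  have "edge_word (prefix_path q) \<in> carrier A"
    using shift_T(2)[of "prefix_path q" "cycle c"] single by (intro edge_word_closed) (simp add: prefix_path)
  then show ?case
    unfolding section_map_single scale_eq_mult
    by (intro A0_closed(5) v_A0 free_algebra_closed) (auto simp: zero_free_monoid_def)
qed (auto simp: section_map_zero section_map_add intro: A0_closed)

text \<open>The choice made by \<open>prefix_path\<close> disappears modulo J, so the map can be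
  evaluated with whichever initial path is convenient.\<close>

lemma section_map_path:
  assumes "es @- cycle c \<in> T"
  shows "edge_word es * v - section_map (Poly_Mapping.single (es @- cycle c) 1) \<in> J"
  using edge_word_determined[OF assms, of "prefix_path (es @- cycle c)"] prefix_path[OF assms]
  by (simp add: section_map_single)

text \<open>Once the path starts with an edge f, the relations reduce xf to f, to a path of length
  two, to the vertex r(f) or to zero, in the same cases in which \<open>gen_action\<close> fixes,
  extends, shortens or kills q.\<close>

lemma section_map_gen_basis:
  assumes x: "x \<in> lpa_gens G" and q: "q \<in> T"
  shows "gen x * section_map (Poly_Mapping.single q 1) - section_map (gen_action G x q) \<in> J"
proof -
  \<comment> \<open>The additional c guarantees a first edge. On the path v of length 0, the ghost
    of an edge leaving the base would give only that ghost again.\<close>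
  define es where "es = prefix_path q @ c"
  have es: "es @- cycle c = q" "es \<noteq> []"
    using prefix_path[OF q] by (simp_all add: es_def)
  then obtain f fs where f: "es = f # fs" by (cases es) auto
  then have q_eq: "q = f ## (fs @- cycle c)" using es by simp
  then have fT: "f \<in> arcs G" "head G f = tail G (shd (fs @- cycle c))" "fs @- cycle c \<in> T"
    using q by (simp_all add: T_SCons)
  let ?r = "edge_word fs * v"
  have rA: "?r \<in> carrier A"
    using shift_T(2)[OF fT(3)] by (intro free_algebra_closed edge_word_closed v_A)
  have gA: "gen x \<in> carrier A" using x by (rule free_algebra_closed)
  have "gen (Edge f) * ?r - section_map (Poly_Mapping.single q 1) \<in> J"
    using section_map_path[of es] es q by (simp add: f mult.assoc)
  then have "gen x * (section_map (Poly_Mapping.single q 1) - gen (Edge f) * ?r) \<in> J"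
    by (intro J_mult[OF J_sym gA])
  then have 1: "gen x * section_map (Poly_Mapping.single q 1) - gen x * gen (Edge f) * ?r \<in> J"
    by (simp add: algebra_simps)
  have zero: "gen x * gen (Edge f) * ?r - 0 \<in> J" if "gen x * gen (Edge f) \<in> I"
    using that rA by (simp add: I_subset_J I_closed)
  have "gen x * gen (Edge f) * ?r - section_map (gen_action G x q) \<in> J"
  proof (cases x)
    case (Vertex u)
    show ?thesis
    proof (cases "u = tail G f")
      case True
      have "(gen (Vertex u) * gen (Edge f) - gen (Edge f)) * ?r \<in> I"
        using relations_V_E(1)[of "Edge f"] fT rA True by (intro I_closed(6)) auto
      then have "gen x * gen (Edge f) * ?r - gen (Edge f) * ?r \<in> J"
        by (intro I_subset_J) (simp add: Vertex algebra_simps)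
      moreover have "gen (Edge f) * ?r - section_map (gen_action G x q) \<in> J"
        using section_map_path[of es] es q by (simp add: f mult.assoc Vertex True q_eq)
      ultimately show ?thesis by (rule J_trans)
    next
      case False
      then show ?thesis
        using gen_mult_ne[of x "Edge f"] zero x fT by (simp add: Vertex q_eq section_map_zero)
    qed
  next
    case (Edge e)
    show ?thesis
    proof (cases "head G e = tail G f")
      case True
      then show ?thesis
        using section_map_path[of "e # f # fs"] q x by (simp add: Edge q_eq T_SCons mult.assoc)
    next
      case False
      then show ?thesis
        using gen_mult_ne[of x "Edge f"] zero x fT by (simp add: Edge q_eq section_map_zero)
    qed
  next
    case (Ghost e)
    have e: "e \<in> arcs G" using x by (simp add: Ghost)
    show ?thesis
    proof (cases "e = f")
      case True
      have "(gen (Ghost f) * gen (Edge f) - gen (Vertex (head G f))) * ?r \<in> I"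
        using relation_CK1[OF fT(1) fT(1)] rA by (intro I_closed(6)) auto
      then have "gen x * gen (Edge f) * ?r - gen (Vertex (head G f)) * ?r \<in> J"
        by (intro I_subset_J) (simp add: Ghost True algebra_simps)
      \<comment> \<open>Cancelling f leaves its range vertex, which the rest of the path absorbs;
        the rest may have length 0, which \<open>source_path\<close> covers.\<close>
      moreover have "gen (Vertex (head G f)) * ?r - ?r \<in> J"
        using source_path[OF fT(3)] by (intro I_subset_J) (simp add: fT(2))
      moreover have "?r - section_map (gen_action G x q) \<in> J"
        using section_map_path[OF fT(3)] by (simp add: Ghost True q_eq)
      ultimately show ?thesis by (blast intro: J_trans)
    next
      case False
      then show ?thesis
        using relation_CK1[OF e fT(1)] zero by (simp add: Ghost q_eq section_map_zero)
    qed
  qed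
  then show ?thesis by (rule J_trans[OF 1])
qed

lemma section_map_gen:
  assumes x: "x \<in> lpa_gens G" and "m \<in> carrier V"
  shows "gen x * section_map m - section_map (linear_extension (gen_action G x) m) \<in> J"
  using assms(2) unfolding carrier_V
proof (induction m rule: poly_mapping_induct_single)
  case (add m n)
  then show ?case
    using J_add[OF add] by (simp add: section_map_add linear_extension_add algebra_simps)
next
  case (single q a)
  have "scale a (gen x * section_map (Poly_Mapping.single q 1) - section_map (gen_action G x q)) \<in> J"
    using section_map_gen_basis[OF x single] by (rule J_scale)
  moreover have "scale a (y - z) = scale a y - scale a z" for y z :: "('v, 'e) lpa_gen free_monoid \<Rightarrow>\<^sub>0 'k"
    by (simp add: scale_eq_mult right_diff_distrib)
  ultimately show ?case
    by (simp add: section_map_scale section_map_single mult_scale_right)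
qed (simp add: section_map_zero J_zero)

text \<open>The last letter acts first, so a new letter arrives on the left, and congruences modulo
  the left ideal J survive that.\<close>

lemma section_map_word:
  assumes "set xs \<subseteq> lpa_gens G" "m \<in> carrier V"
  shows "Poly_Mapping.single (Word xs) 1 * section_map m - section_map (word_action G (Word xs) m) \<in> J"
  using assms(1)
proof (induction xs)
  case Nil
  have "Word [] = (0 :: ('v, 'e) lpa_gen free_monoid)" by (simp add: zero_free_monoid_def)
  then show ?case by (simp add: word_action_zero J_zero)
next
  case (Cons x xs)
  let ?w = "Poly_Mapping.single (Word xs) 1 :: _ \<Rightarrow>\<^sub>0 'k" and ?n = "word_action G (Word xs) m"
  have n: "?n = free_algebra_action G ?w m" by (simp add: action_single)
  have "?n \<in> carrier V"
    unfolding n using Cons assms(2) by (intro action_closed free_algebra_closed) auto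
  then have "gen x * section_map ?n - section_map (linear_extension (gen_action G x) ?n) \<in> J"
    using Cons by (intro section_map_gen) auto
  moreover have "gen x * (?w * section_map m - section_map ?n) \<in> J"
    using Cons by (intro J_mult free_algebra_closed) auto
  then have "gen x * (?w * section_map m) - gen x * section_map ?n \<in> J"
    by (simp add: right_diff_distrib)
  moreover have "word_action G (Word (x # xs)) m = linear_extension (gen_action G x) ?n"
    by (simp add: word_action_def)
  ultimately show ?case
    using J_trans unfolding single_Word_Cons mult.assoc by metis
qed

lemma section_map_action:
  assumes "p \<in> carrier A" "m \<in> carrier V"
  shows "p * section_map m - section_map (free_algebra_action G p m) \<in> J"
proof -
  have "Poly_Mapping.keys p \<subseteq> words" using assms(1) by (simp add: carrier_free_algebra)
  then show ?thesis
  proof (induction p rule: poly_mapping_induct_single)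
    case (add p q)
    then show ?case
      using J_add[OF add] by (simp add: section_map_add action_add_left algebra_simps)
  next
    case (single w a)
    have "scale a (Poly_Mapping.single w 1 * section_map m - section_map (word_action G w m)) \<in> J"
      using section_map_word[of "letters w" m] single assms(2) by (intro J_scale) simp
    moreover have "scale a (y - z) = scale a y - scale a z" for y z :: "('v, 'e) lpa_gen free_monoid \<Rightarrow>\<^sub>0 'k"
      by (simp add: scale_eq_mult right_diff_distrib)
    ultimately show ?case
      by (simp add: action_single section_map_scale flip: mult_scale_left)
  qed (simp add: section_map_zero action_zero_left J_zero)
qed

text \<open>With \<sigma> for \<open>section_map\<close>, modulo J: pv = p \<sigma>(c^\<infinity>) =
  \<sigma>(p c^\<infinity>) = \<sigma>(0) = 0. The first step holds because the empty path is an
  initial path of c^\<infinity>.\<close>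

lemma annihilator_J:
  assumes "p \<in> carrier A" "free_algebra_action G p c_inf = 0"
  shows "p * v \<in> J"
proof -
  have "p * (v - section_map c_inf) \<in> J"
    using section_map_path[of "[]"] assms(1) by (intro J_mult) simp_all
  moreover have "p * section_map c_inf \<in> J"
    using section_map_action[OF assms(1) c_inf_V] by (simp add: assms(2) section_map_zero)
  ultimately show ?thesis
    using J_add[of "p * (v - section_map c_inf)" "p * section_map c_inf"] by (simp add: algebra_simps)
qed

lemma v_action: "free_algebra_action G v c_inf = c_inf"
  by (simp add: action_gen)

lemma path_action:
  assumes "es @- cycle c \<in> T"
  shows "free_algebra_action G (edge_word es) c_inf = Poly_Mapping.single (es @- cycle c) 1"
  using assms by (induction es) (auto simp: action_one action_mult action_gen T_SCons)

lemma cw_action: "free_algebra_action G cw c_inf = c_inf"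
  using path_action[of c] by simp

text \<open>Here \<gamma> v sends c^\<infinity> to \<gamma> c^\<infinity>, an exact equality and not
  one modulo J. This makes V cyclic (\<open>generates\<close>).\<close>

lemma section_map_c_inf:
  "m \<in> carrier V \<Longrightarrow> free_algebra_action G (section_map m) c_inf = m"
  unfolding carrier_V
proof (induction m rule: poly_mapping_induct_single)
  case (single q a)
  then show ?case
    using path_action[of "prefix_path q"]
    by (simp add: section_map_single action_scale_left action_mult v_action prefix_path)
qed (simp_all add: section_map_zero section_map_add action_zero_left action_add_left)

section \<open>The two instances of the cyclic resolution\<close>

lemma no_fixed_point:
  assumes "r \<in> carrier L" "r \<otimes>\<^bsub>L\<^esub> lpa_class G cw = r"
  shows "r = \<zero>\<^bsub>L\<^esub>"
proof -
  obtain p where p: "p \<in> A0" "r = lpa_class G p" using assms(1) by (auto simp: carrier_L)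
  have "p * cw - p \<in> I"
    using assms(2) p cw_A0 by (simp add: mult_L class_eq_iff)
  moreover have "0 < word_degree (Word (map Edge c) :: ('v, 'e) lpa_gen free_monoid)"
    by (simp add: word_degree_def comp_def sum_list_triv)
  moreover have "Word (map Edge c) \<in> words" using arcs_c by auto
  ultimately have "p \<in> I"
    using no_fixed_point_modulo_I[of p "Word (map Edge c)"] p(1) by (simp add: edge_word_def A0_subset)
  then show ?thesis by (simp add: p(2) zero_L class_eq_iff)
qed

lemma generates: "m \<in> carrier V \<Longrightarrow> \<exists>r\<in>carrier L. m = r \<odot>\<^bsub>V\<^esub> c_inf"
  by (intro bexI[of _ "lpa_class G (section_map m)"])
     (simp_all add: smult_V A0_subset section_map_A0 c_inf_V section_map_c_inf carrier_L)

lemma vertex_resolution: "cyclic_module_resolution L V (lpa_class G v) (lpa_class G cw) c_inf"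
proof (unfold_locales)
  fix r assume r: "r \<in> carrier L" "r \<otimes>\<^bsub>L\<^esub> lpa_class G v = r" "r \<odot>\<^bsub>V\<^esub> c_inf = \<zero>\<^bsub>V\<^esub>"
  obtain p where p: "p \<in> A0" "r = lpa_class G p" using r(1) by (auto simp: carrier_L)
  have pv: "p * v - p \<in> I" using r(2) p v_A0 by (simp add: mult_L class_eq_iff)
  have "p * v \<in> J"
    using r(3) p by (intro annihilator_J) (simp_all add: A0_subset smult_V c_inf_V V_simps)
  then obtain s where s: "s \<in> carrier A" "p * v - s * (cw - v) \<in> I" by (auto simp: J_def)
  \<comment> \<open>The factor s may have a constant term and then need not define an element of L;
    sv does, and v (c - v) is congruent to c - v.\<close>
  have sv: "s * v \<in> A0" using s v_A0 by (intro A0_closed(5))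
  have "p - (s * v) * (cw - v) =
      ((p * v - s * (cw - v)) - (p * v - p)) + s * ((v * v - v) - (v * cw - cw))"
    by (simp add: algebra_simps)
  moreover have "\<dots> \<in> I"
    by (rule I_closed(2)[OF I_closed(4)[OF s(2) pv] I_closed(5)[OF s(1) I_closed(4)[OF v_v v_cw]]])
  ultimately have "p - (s * v) * (cw - v) \<in> I" by (simp only:)
  then have "r = lpa_class G (s * v) \<otimes>\<^bsub>L\<^esub> (lpa_class G cw \<ominus>\<^bsub>L\<^esub> lpa_class G v)"
    using sv cw_A0 v_A0 by (simp add: p(2) mult_L minus_L A0_closed class_eq_iff)
  then show "\<exists>s\<in>carrier L. r = s \<otimes>\<^bsub>L\<^esub> (lpa_class G cw \<ominus>\<^bsub>L\<^esub> lpa_class G v)"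
    using sv by (auto simp: carrier_L)
qed (use generates no_fixed_point v_A0 cw_A0 v_v v_cw cw_v c_inf_V v_action cw_action
     in \<open>auto simp: carrier_L mult_L class_eq_iff smult_V A0_subset\<close>)

text \<open>An r that kills c^\<infinity> only yields rv in J, since r(1 - v) kills c^\<infinity> in
  any case. That second part has to be written as a multiple of c - 1 separately.\<close>

lemma unit_resolution:
  assumes fin: "finite (verts G)"
  shows "cyclic_module_resolution L V \<one>\<^bsub>L\<^esub> (lpa_class G cw) c_inf"
proof -
  define u where "u = (\<Sum>v\<in>verts G. gen (Vertex v) :: ('v, 'e) lpa_gen free_monoid \<Rightarrow>\<^sub>0 'k)"
  have one: "\<one>\<^bsub>L\<^esub> = lpa_class G u" by (simp add: one_L u_def)
  have u: "u \<in> A0" unfolding u_def by (rule one_in_A0)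
  have um: "u * p - p \<in> I" "p * u - p \<in> I" if "p \<in> A0" for p
    using one_mult[OF fin that] by (simp_all add: u_def)
  have u_action: "free_algebra_action G u c_inf = c_inf"
  proof -
    \<comment> \<open>As v fixes c^\<infinity>, the element u acts on it like uv, which is congruent
      to v.\<close>
    have "free_algebra_action G (u * v) c_inf = free_algebra_action G ((u * v - v) + v) c_inf" by simp
    then show ?thesis
      using I_annihilates[OF um(1)[OF v_A0] c_inf_V]
      by (simp only: action_add_left action_mult v_action add_0)
  qed
  show ?thesis
    unfolding one
  proof (unfold_locales)
    fix r assume r: "r \<in> carrier L" "r \<odot>\<^bsub>V\<^esub> c_inf = \<zero>\<^bsub>V\<^esub>"
    obtain p where p: "p \<in> A0" "r = lpa_class G p" using r(1) by (auto simp: carrier_L)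
    have "p * v \<in> J"
      using r(2) p by (intro annihilator_J) (simp_all add: A0_subset smult_V c_inf_V V_simps)
    then obtain s where s: "s \<in> carrier A" "p * v - s * (cw - v) \<in> I" by (auto simp: J_def)
    \<comment> \<open>From vc = c one gets sv (c - 1) = s (c - v) = pv and (p - pv)(c - 1) = -(p -
      pv), so the two terms of t contribute pv and p - pv.\<close>
    define t where "t = s * v - (p - p * v)"
    have t: "t \<in> A0"
      unfolding t_def using s p v_A0 by (intro A0_closed(4,5)) (auto intro: A0_subset)
    have "p - t * (cw - u) = (p * v - s * (cw - v)) - (p * u - p) - s * (v * cw - cw) + s * (v * u - v)
        - p * (v * cw - cw) + p * (v * u - v)"
      by (simp add: t_def algebra_simps)
    moreover have "\<dots> \<in> I"
      using um(2)[OF p(1)] um(2)[OF v_A0] s A0_subset[OF p(1)] v_cw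
      by (intro I_closed(2)[OF I_closed(4)[OF I_closed(2)[OF I_closed(4)[OF I_closed(4)]]]] I_closed(5))
    ultimately have "p - t * (cw - u) \<in> I" by (simp only:)
    then have "r = lpa_class G t \<otimes>\<^bsub>L\<^esub> (lpa_class G cw \<ominus>\<^bsub>L\<^esub> lpa_class G u)"
      using t cw_A0 u by (simp add: p(2) mult_L minus_L A0_closed class_eq_iff)
    then show "\<exists>s\<in>carrier L. r = s \<otimes>\<^bsub>L\<^esub> (lpa_class G cw \<ominus>\<^bsub>L\<^esub> lpa_class G u)"
      using t by (auto simp: carrier_L)
  qed (use generates no_fixed_point u cw_A0 um c_inf_V u_action cw_action
       in \<open>auto simp: carrier_L mult_L class_eq_iff smult_V A0_subset\<close>)
qed

end

theorem theorem2p8: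
  fixes K :: "'k::field itself" and G :: "('v, 'e) pre_digraph" and c :: "'e list"
  assumes "wf_digraph G" and "simple_closed_path G c"
  shows "let
      L = leavitt_path_algebra K G;
      v = lpa_vertex K G (tail G (hd c));
      c' = lpa_path K G c;
      Lv = left_ideal_module L (principal_left_ideal L v);
      LL = left_ideal_module L (carrier L);
      V = chen_module K G (cycle c);
      c_inf = Poly_Mapping.single (cycle c) (1::'k)
    in
      finitely_presented L V \<and>
      short_projective_resolution TYPE('m) TYPE('n) L
        Lv (\<lambda>r. r \<otimes>\<^bsub>L\<^esub> (c' \<ominus>\<^bsub>L\<^esub> v)) Lv (\<lambda>r. r \<odot>\<^bsub>V\<^esub> c_inf) V \<and>
      (fin_digraph G \<longrightarrow>
        short_projective_resolution TYPE('m) TYPE('n) L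
          LL (\<lambda>r. r \<otimes>\<^bsub>L\<^esub> (c' \<ominus>\<^bsub>L\<^esub> \<one>\<^bsub>L\<^esub>)) LL (\<lambda>r. r \<odot>\<^bsub>V\<^esub> c_inf) V)"
proof -
  interpret chen_cycle G K c
    by (intro chen_cycle.intro chen.intro leavitt.intro chen_cycle_axioms.intro assms)
  interpret vertex: cyclic_module_resolution L V "lpa_class G v" "lpa_class G cw" c_inf
    by (rule vertex_resolution)
  have unit: "short_projective_resolution TYPE('m) TYPE('n) L
      (left_ideal_module L (carrier L)) (\<lambda>r. r \<otimes>\<^bsub>L\<^esub> (lpa_class G cw \<ominus>\<^bsub>L\<^esub> \<one>\<^bsub>L\<^esub>))
      (left_ideal_module L (carrier L)) (\<lambda>r. r \<odot>\<^bsub>V\<^esub> c_inf) V"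
    if "finite (verts G)"
  proof -
    interpret unit: cyclic_module_resolution L V "\<one>\<^bsub>L\<^esub>" "lpa_class G cw" c_inf
      by (rule unit_resolution[OF that])
    have "r \<otimes>\<^bsub>L\<^esub> \<one>\<^bsub>L\<^esub> = r" if "r \<in> carrier L" for r
    proof -
      obtain p where p: "p \<in> A0" "r = lpa_class G p" using \<open>r \<in> carrier L\<close> by (auto simp: carrier_L)
      then show ?thesis
        using one_mult[OF \<open>finite (verts G)\<close> p(1)] one_in_A0 by (simp only: one_L mult_L class_eq_iff)
    qed
    \<comment> \<open>For e = 1 the left ideal of the abstract resolution is all of L.\<close>
    then have "principal_left_ideal L \<one>\<^bsub>L\<^esub> = carrier L"
      by (auto simp: principal_left_ideal_def image_iff)
    then show ?thesis using unit.resolution by simp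
  qed
  show ?thesis
    unfolding Let_def lpa_vertex_def lpa_path_def prod_list_edges
    using vertex.presentation vertex.resolution unit by (auto dest: fin_digraph.finite_verts)
qed

end
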